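(* Let $m,p\in\mathbb{N}$. (a) For $x=(x_1,x_2)\in\mathbb{R}^2$ set $v_{1,k}=\mathrm{Re}\,(x_1+ix_2)^{m-2k}\,|x|^{2k}$ and $v_{2,k}=\mathrm{Im}\,(x_1+ix_2)^{m-2k}\,|x|^{2k}$. Then $$\{v_{1,k},v_{2,k}\colon k=0,\dots,p-1\}$$ is a vector space basis of $\mathcal{H}_m^p(\mathbb{R}^2)$. (b) Let $n>2$ and set $v_{k,\alpha(k)}=|x|^{2k}K[D^{\alpha(k)}|x|^{2-n}]$. Then the set $$\{v_{k,\alpha(k)}\colon \alpha(k)\in\mathbb{N}_0^n,\ |\alpha(k)|=m-2k,\ \alpha(k)_1\le 1,\ k=0,\dots,p-1\}$$ is a vector space basis of $\mathcal{H}_m^p(\mathbb{R}^n)$.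
   Context: $\mathcal{H}_m^p(\mathbb{R}^n)$ is the complex vector space of homogeneous polynomials $q$ of degree $m$ on $\mathbb{R}^n$ (including zero) that are polyharmonic of order $p$, i.e. $\Delta^pq=0$ with $\Delta=\sum_j\partial^2/\partial x_j^2$. $|x|=(\sum_jx_j^2)^{1/2}$. $\mathbb{N}_0=\{0,1,2,\dots\}$; for a multi-index $\alpha$, $|\alpha|=\sum_j\alpha_j$, and $\alpha(k)_1$ is the first component of $\alpha(k)$. The Kelvin transform is $K[f](x)=|x|^{2-n}f(x/|x|^2)$ for $f$ on $\mathbb{R}^n\setminus\{0\}$; a function on $\mathbb{R}^n\setminus\{0\}$ agreeing there with a polynomial is identified with that polynomial.
   Formalization: In (a) only v_{1,k} with 2k ≤ m and v_{2,k} with 2k < m are listed: when 2(p−1) ≥ m the printed set contains the zero function v_{2,m/2} or the dependent pair v_{2,k} = −v_{2,m−k}, so it is not a basis; when 2(p−1) < m it is unchanged. *)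

theory Defs
  imports "HOL-Analysis.Analysis" "HOL-Library.Function_Algebras"
begin

definition cscale :: "complex \<Rightarrow> ('a \<Rightarrow> complex) \<Rightarrow> 'a \<Rightarrow> complex" where
  "cscale c f = (\<lambda>x. c * f x)"

interpretation cfun: vector_space "cscale :: complex \<Rightarrow> ('a \<Rightarrow> complex) \<Rightarrow> 'a \<Rightarrow> complex"
  by standard (auto simp: cscale_def fun_eq_iff algebra_simps)

definition is_basis_of :: "('a \<Rightarrow> complex) set \<Rightarrow> ('a \<Rightarrow> complex) set \<Rightarrow> bool" where
  "is_basis_of B V \<longleftrightarrow> cfun.independent B \<and> cfun.span B = V"

definition partial_deriv :: "'n::finite \<Rightarrow> (real^'n \<Rightarrow> complex) \<Rightarrow> real^'n \<Rightarrow> complex" where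
  "partial_deriv i f x = vector_derivative (\<lambda>t. f (x + t *\<^sub>R axis i 1)) (at 0)"

definition laplacian :: "(real^'n \<Rightarrow> complex) \<Rightarrow> real^'n \<Rightarrow> complex" where
  "laplacian f x = (\<Sum>i\<in>UNIV. partial_deriv i (partial_deriv i f) x)"

text \<open>
  The coordinates of \<open>real^'n\<close> are ordered by the linear order on \<open>'n\<close>; the first one is
  \<open>Min UNIV\<close>. The partial derivatives are applied last coordinate first.
\<close>

definition multi_deriv ::
    "('n::{finite,linorder} \<Rightarrow> nat) \<Rightarrow>
     (real^('n::{finite,linorder}) \<Rightarrow> complex) \<Rightarrow> real^('n::{finite,linorder}) \<Rightarrow> complex" where
  "multi_deriv \<alpha> f = foldr (\<lambda>i. partial_deriv i ^^ \<alpha> i) (sorted_list_of_set UNIV) f"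

definition homogeneous_polynomial :: "nat \<Rightarrow> (real^'n \<Rightarrow> complex) \<Rightarrow> bool" where
  "homogeneous_polynomial m q \<longleftrightarrow>
     (\<exists>c. \<forall>x. q x =
        (\<Sum>\<alpha> | (\<Sum>i\<in>UNIV. \<alpha> i) = m. c \<alpha> * complex_of_real (\<Prod>i\<in>UNIV. (x $ i) ^ \<alpha> i)))"

definition polyharmonic_homogeneous :: "nat \<Rightarrow> nat \<Rightarrow> (real^'n \<Rightarrow> complex) set" where
  "polyharmonic_homogeneous m p =
     {q. homogeneous_polynomial m q \<and> (laplacian ^^ p) q = (\<lambda>x. 0)}"

text \<open>
  Functions on the punctured space are represented by total functions whose value at 0 is
  irrelevant; \<open>as_polynomial\<close> replaces such a function by the polynomial (unique, by continuity)
  that agrees with it away from 0.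
\<close>

definition kelvin :: "(real^'n \<Rightarrow> complex) \<Rightarrow> real^'n \<Rightarrow> complex" where
  "kelvin f x = complex_of_real (norm x powi (2 - int CARD('n))) * f (x /\<^sub>R (norm x)\<^sup>2)"

definition as_polynomial :: "(real^'n \<Rightarrow> complex) \<Rightarrow> real^'n \<Rightarrow> complex" where
  "as_polynomial f = (THE q. polynomial_function q \<and> (\<forall>x. x \<noteq> 0 \<longrightarrow> q x = f x))"

text \<open>
  The exponent \<open>m - 2 * k\<close> is truncated, so these two are only meaningful for \<open>2 * k \<le> m\<close>;
  \<open>v_im m k\<close> is the zero function when \<open>2 * k = m\<close>.
\<close>

definition v_re :: "nat \<Rightarrow> nat \<Rightarrow> real^2 \<Rightarrow> complex" where
  "v_re m k x = complex_of_real (Re (Complex (x $ 1) (x $ 2) ^ (m - 2 * k)) * norm x ^ (2 * k))"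

definition v_im :: "nat \<Rightarrow> nat \<Rightarrow> real^2 \<Rightarrow> complex" where
  "v_im m k x = complex_of_real (Im (Complex (x $ 1) (x $ 2) ^ (m - 2 * k)) * norm x ^ (2 * k))"

definition v_kelvin ::
    "nat \<Rightarrow> ('n::{finite,linorder} \<Rightarrow> nat) \<Rightarrow> real^('n::{finite,linorder}) \<Rightarrow> complex" where
  "v_kelvin k \<alpha> = as_polynomial (\<lambda>x. complex_of_real (norm x ^ (2 * k)) *
     kelvin (multi_deriv \<alpha> (\<lambda>y. complex_of_real (norm y powi (2 - int CARD('n))))) x)"

end

theory Submission
  imports Defs
begin

text \<open>
  Both parts are instances of one statement about leading monomials. Fix a coordinate \<open>i0\<close> and
  suppose that every multi-index \<open>\<alpha>\<close> with \<open>\<alpha> i0 \<le> 1\<close> comes with a harmonic homogeneous polynomial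
  \<open>h \<alpha>\<close> of degree \<open>|\<alpha>|\<close> that equals a nonzero multiple of \<open>x\<^sup>\<alpha>\<close> modulo \<open>|x|\<^sup>2\<close>. Then the products
  \<open>|x|\<^sup>2\<^sup>k h \<alpha>\<close> with \<open>|\<alpha>| + 2 k = m\<close> form a basis of all homogeneous polynomials of degree \<open>m\<close>,
  and those with \<open>k < p\<close> form a basis of the polyharmonic ones of order \<open>p\<close>.

  Spanning is division with remainder: \<open>x\<^sub>i\<^sub>0\<^sup>2\<close> equals \<open>|x|\<^sup>2\<close> minus the other squares, so
  modulo \<open>|x|\<^sup>2\<close> only monomials with \<open>\<alpha> i0 \<le> 1\<close> remain, these are the \<open>h \<alpha>\<close> up to scalars, and
  the quotient by \<open>|x|\<^sup>2\<close> has lower degree (\<open>monomial_in_span_family\<close>). Independence is then a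
  count: writing the exponent of \<open>x\<^sub>i\<^sub>0\<close> as \<open>2 k\<close> plus a remainder at most one matches the
  products with the monomials of degree \<open>m\<close> (\<open>independent_family_all\<close>). Finally \<open>\<Delta>\<^sup>k(|x|\<^sup>2\<^sup>k H)\<close>
  is a nonzero multiple of \<open>H\<close> for harmonic \<open>H\<close> while \<open>\<Delta>\<^sup>k\<^sup>+\<^sup>1\<close> kills \<open>|x|\<^sup>2\<^sup>k H\<close>, so \<open>\<Delta>\<^sup>p q = 0\<close>
  forces all layers with \<open>k \<ge> p\<close> to vanish (\<open>top_layer_vanishes\<close>, \<open>polyharmonic_in_span_family\<close>).

  In the plane the \<open>h \<alpha>\<close> are the real and imaginary parts of \<open>(x\<^sub>1 + i x\<^sub>2)\<^sup>d\<close>, whose leading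
  monomials are \<open>x\<^sub>1\<^sup>d\<close> and \<open>x\<^sub>1\<^sup>d\<^sup>-\<^sup>1 x\<^sub>2\<close> (\<open>z_triangular\<close>). For \<open>n > 2\<close>, differentiating
  \<open>|x|\<^sup>2\<^sup>-\<^sup>n\<close> repeatedly gives \<open>|x|\<^sup>2\<^sup>-\<^sup>n\<^sup>-\<^sup>2\<^sup>d h\<close> with \<open>h\<close> a polynomial, \<open>d = |\<alpha>|\<close>; each
  derivative acts on \<open>h\<close> by an explicit operator that preserves harmonicity and multiplies the
  leading monomial by \<open>(2 - n - 2 d) x\<^sub>i\<close> (\<open>laplacian_newtonian_step\<close>, \<open>newtonian_form_partial_deriv\<close>).
  The Kelvin transform strips off the radial factor and leaves \<open>h\<close> (\<open>v_kelvin_eq\<close>).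
\<close>

section \<open>Monomials and homogeneous polynomials\<close>

definition coord :: "'n::finite \<Rightarrow> real^'n \<Rightarrow> complex" where
  "coord i = (\<lambda>x. complex_of_real (x $ i))"

definition rsq :: "real^'n::finite \<Rightarrow> complex" where
  "rsq = (\<lambda>x. complex_of_real ((norm x)\<^sup>2))"

definition monomial :: "('n::finite \<Rightarrow> nat) \<Rightarrow> real^'n \<Rightarrow> complex" where
  "monomial \<alpha> = (\<lambda>x. complex_of_real (\<Prod>i\<in>UNIV. (x $ i) ^ \<alpha> i))"

definition exponents :: "nat \<Rightarrow> ('n::finite \<Rightarrow> nat) set" where
  "exponents d = {\<alpha>. (\<Sum>i\<in>UNIV. \<alpha> i) = d}"

lemma sum_fun_apply: "sum f A x = (\<Sum>a\<in>A. f a x)"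
  by (induction A rule: infinite_finite_induct) auto

lemma power_fun_apply: "(f ^ k) x = (f x) ^ k" for f :: "'a \<Rightarrow> complex"
  by (induction k) auto

text \<open>
  The polynomial identities below are identities in the commutative ring of functions. Automatic
  pointwise evaluation would expand the ring operations under abstractions and hide this
  structure.
\<close>
lemmas fun_apply_simps = plus_fun_apply zero_fun_apply times_fun_apply one_fun_apply
  uminus_apply minus_apply
  numeral_fun_apply of_nat_fun_apply

declare fun_apply_simps [simp del]

lemma cscale_eq_times: "cscale c f = (\<lambda>_. c) * f"
  by (simp add: cscale_def times_fun_def)

lemma finite_exponents: "finite (exponents d :: ('n::finite \<Rightarrow> nat) set)"
proof (rule finite_subset)
  show "exponents d \<subseteq> PiE (UNIV :: 'n set) (\<lambda>_. {..d})"
    by (auto simp: exponents_def intro!: member_le_sum)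
  show "finite (PiE (UNIV :: 'n set) (\<lambda>_. {..d}))"
    by (intro finite_PiE) auto
qed

lemma exponents_0: "exponents 0 = {\<lambda>_::'n::finite. 0}"
  by (auto simp: exponents_def)

lemma sum_fun_upd:
  fixes \<alpha> :: "'n::finite \<Rightarrow> nat"
  shows "(\<Sum>j\<in>UNIV. (\<alpha>(i := v)) j) + \<alpha> i = (\<Sum>j\<in>UNIV. \<alpha> j) + v"
proof -
  have "(\<Sum>j\<in>UNIV. (\<alpha>(i := v)) j) = v + (\<Sum>j\<in>UNIV - {i}. \<alpha> j)"
    by (subst sum.remove[of _ i]) (auto intro!: sum.cong)
  moreover have "(\<Sum>j\<in>UNIV. \<alpha> j) = \<alpha> i + (\<Sum>j\<in>UNIV - {i}. \<alpha> j)"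
    by (subst sum.remove[of _ i]) auto
  ultimately show ?thesis by simp
qed

lemma exponents_incr:
  "\<alpha>(i := \<alpha> i + k) \<in> exponents (d + k) \<longleftrightarrow> \<alpha> \<in> exponents d"
  using sum_fun_upd[of \<alpha> i "\<alpha> i + k"] by (simp add: exponents_def)

text \<open>
  Descent on the degree: every monomial of positive degree is a coordinate times a monomial of
  lower degree. It drives the inductions on the degree below.
\<close>
lemma exponents_Suc_cases:
  fixes \<alpha> :: "'n::finite \<Rightarrow> nat"
  assumes "\<alpha> \<in> exponents (Suc d)"
  obtains i \<beta> where "\<beta> \<in> exponents d" "\<alpha> = \<beta>(i := \<beta> i + 1)"
proof -
  obtain i where i: "\<alpha> i > 0"
    using assms by (force simp: exponents_def)
  define \<beta> where "\<beta> = \<alpha>(i := \<alpha> i - 1)"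
  have eq: "\<alpha> = \<beta>(i := \<beta> i + 1)" using i by (auto simp: \<beta>_def)
  show ?thesis
    using that[OF _ eq] assms exponents_incr[of \<beta> i 1 d] eq by simp
qed

lemma monomial_apply: "monomial \<alpha> x = (\<Prod>i\<in>UNIV. coord i x ^ \<alpha> i)"
  by (simp add: monomial_def coord_def)

lemma monomial_0: "monomial (\<lambda>_. 0) = 1"
  by (simp add: monomial_def one_fun_def)

lemma monomial_incr:
  fixes \<alpha> :: "'n::finite \<Rightarrow> nat"
  shows "monomial (\<alpha>(i := \<alpha> i + k)) = coord i ^ k * monomial \<alpha>"
proof
  fix x :: "real^'n"
  have "monomial (\<alpha>(i := \<alpha> i + k)) x
      = coord i x ^ (\<alpha> i + k) * (\<Prod>j\<in>UNIV - {i}. coord j x ^ \<alpha> j)"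
    unfolding monomial_apply by (subst prod.remove[of _ i]) (auto intro!: prod.cong)
  also have "\<dots> = coord i x ^ k * (coord i x ^ \<alpha> i * (\<Prod>j\<in>UNIV - {i}. coord j x ^ \<alpha> j))"
    by (simp add: power_add)
  also have "coord i x ^ \<alpha> i * (\<Prod>j\<in>UNIV - {i}. coord j x ^ \<alpha> j) = monomial \<alpha> x"
    unfolding monomial_apply by (subst (2) prod.remove[of _ i]) auto
  finally show "monomial (\<alpha>(i := \<alpha> i + k)) x = (coord i ^ k * monomial \<alpha>) x"
    by (simp add: power_fun_apply times_fun_apply del: fun_upd_apply)
qed

lemma rsq_eq_sum: "rsq = (\<Sum>i\<in>UNIV. coord i ^ 2)"
proof
  fix x :: "real^'n"
  have "(norm x)\<^sup>2 = (\<Sum>i\<in>UNIV. (x $ i)\<^sup>2)"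
    unfolding power2_norm_eq_inner inner_vec_def by (simp add: power2_eq_square)
  then have "rsq x = complex_of_real (\<Sum>i\<in>UNIV. (x $ i)\<^sup>2)"
    by (simp only: rsq_def)
  then show "rsq x = (\<Sum>i\<in>UNIV. coord i ^ 2) x"
    by (simp add: sum_fun_apply power_fun_apply coord_def)
qed

lemma homogeneous_polynomial_iff:
  "homogeneous_polynomial d q \<longleftrightarrow> (\<exists>c. q = (\<Sum>\<alpha>\<in>exponents d. cscale (c \<alpha>) (monomial \<alpha>)))"
  unfolding homogeneous_polynomial_def exponents_def monomial_def fun_eq_iff sum_fun_apply
    cscale_def ..

lemma homogeneous_monomial:
  assumes "\<alpha> \<in> exponents d"
  shows "homogeneous_polynomial d (monomial \<alpha>)"
proof -
  have "(\<Sum>\<beta>\<in>exponents d. cscale (if \<beta> = \<alpha> then 1 else 0) (monomial \<beta>))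
      = (\<Sum>\<beta>\<in>exponents d. if \<beta> = \<alpha> then monomial \<beta> else 0)"
    by (intro sum.cong refl) simp
  also have "\<dots> = monomial \<alpha>"
    using assms finite_exponents by (subst sum.delta) auto
  finally show ?thesis unfolding homogeneous_polynomial_iff
    by (rule exI[where x = "\<lambda>\<beta>. if \<beta> = \<alpha> then 1 else 0", OF sym])
qed

lemma subspace_homogeneous: "cfun.subspace {q. homogeneous_polynomial d q}"
proof (rule cfun.subspaceI, unfold mem_Collect_eq homogeneous_polynomial_iff)
  show "\<exists>c. (0 :: real^'n \<Rightarrow> complex) = (\<Sum>\<alpha>\<in>exponents d. cscale (c \<alpha>) (monomial \<alpha>))"
    by (rule exI[of _ "\<lambda>_. 0"]) simp
next
  fix f g :: "real^'n \<Rightarrow> complex"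
  assume "\<exists>c. f = (\<Sum>\<alpha>\<in>exponents d. cscale (c \<alpha>) (monomial \<alpha>))"
    and "\<exists>c. g = (\<Sum>\<alpha>\<in>exponents d. cscale (c \<alpha>) (monomial \<alpha>))"
  then obtain a b where "f = (\<Sum>\<alpha>\<in>exponents d. cscale (a \<alpha>) (monomial \<alpha>))"
    and "g = (\<Sum>\<alpha>\<in>exponents d. cscale (b \<alpha>) (monomial \<alpha>))" by blast
  then show "\<exists>c. f + g = (\<Sum>\<alpha>\<in>exponents d. cscale (c \<alpha>) (monomial \<alpha>))"
    by (intro exI[of _ "\<lambda>x. a x + b x"]) (simp add: cfun.scale_left_distrib sum.distrib)
next
  fix k and f :: "real^'n \<Rightarrow> complex"
  assume "\<exists>c. f = (\<Sum>\<alpha>\<in>exponents d. cscale (c \<alpha>) (monomial \<alpha>))"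
  then obtain a where "f = (\<Sum>\<alpha>\<in>exponents d. cscale (a \<alpha>) (monomial \<alpha>))" by blast
  then show "\<exists>c. cscale k f = (\<Sum>\<alpha>\<in>exponents d. cscale (c \<alpha>) (monomial \<alpha>))"
    by (intro exI[of _ "\<lambda>x. k * a x"]) (simp add: cfun.scale_sum_right)
qed

lemma homogeneous_eq_span_monomials: "{q. homogeneous_polynomial d q} = cfun.span (monomial ` exponents d)"
proof
  show "{q. homogeneous_polynomial d q} \<subseteq> cfun.span (monomial ` exponents d)"
    by (auto simp: homogeneous_polynomial_iff intro!: cfun.span_sum cfun.span_scale intro: cfun.span_base)
  show "cfun.span (monomial ` exponents d) \<subseteq> {q. homogeneous_polynomial d q}"
    by (rule cfun.span_minimal[OF _ subspace_homogeneous]) (auto simp: homogeneous_monomial)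
qed

lemma homogeneous_0: "homogeneous_polynomial d 0"
  using cfun.subspace_0[OF subspace_homogeneous] by blast

lemma homogeneous_add:
  "homogeneous_polynomial d f \<Longrightarrow> homogeneous_polynomial d g \<Longrightarrow> homogeneous_polynomial d (f + g)"
  using cfun.subspace_add[OF subspace_homogeneous] by blast

lemma homogeneous_diff:
  "homogeneous_polynomial d f \<Longrightarrow> homogeneous_polynomial d g \<Longrightarrow> homogeneous_polynomial d (f - g)"
  using cfun.subspace_diff[OF subspace_homogeneous] by blast

lemma homogeneous_scale: "homogeneous_polynomial d f \<Longrightarrow> homogeneous_polynomial d (cscale c f)"
  using cfun.subspace_scale[OF subspace_homogeneous] by blast

lemma homogeneous_sum:
  assumes "\<And>a. a \<in> A \<Longrightarrow> homogeneous_polynomial d (h a)"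
  shows "homogeneous_polynomial d (sum h A)"
proof -
  have "sum h A \<in> {q. homogeneous_polynomial d q}"
    by (rule cfun.subspace_sum[OF subspace_homogeneous]) (simp add: assms)
  then show ?thesis by simp
qed

lemma homogeneous_coord_mult:
  assumes "homogeneous_polynomial d f"
  shows "homogeneous_polynomial (Suc d) (coord i * f)"
proof -
  have "f \<in> cfun.span (monomial ` exponents d)" using assms homogeneous_eq_span_monomials by blast
  then show ?thesis
  proof (induction rule: cfun.span_induct_alt)
    case base
    show "homogeneous_polynomial (Suc d) (coord i * 0)" by (simp add: homogeneous_0)
  next
    case (step c g f)
    then obtain \<alpha> where \<alpha>: "\<alpha> \<in> exponents d" "g = monomial \<alpha>" by blast
    have "coord i * g = monomial (\<alpha>(i := \<alpha> i + 1))"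
      using \<alpha> monomial_incr[of \<alpha> i 1] by simp
    moreover have "homogeneous_polynomial (Suc d) (monomial (\<alpha>(i := \<alpha> i + 1)))"
      using \<alpha> exponents_incr[of \<alpha> i 1 d] by (intro homogeneous_monomial) simp
    moreover have "coord i * (cscale c g + f) = cscale c (coord i * g) + coord i * f"
      by (simp add: cscale_eq_times algebra_simps)
    ultimately show "homogeneous_polynomial (Suc d) (coord i * (cscale c g + f))"
      using step by (simp add: homogeneous_add homogeneous_scale)
  qed
qed

lemma homogeneous_rsq_mult:
  assumes "homogeneous_polynomial d f"
  shows "homogeneous_polynomial (d + 2) (rsq * f)"
proof -
  have "rsq * f = (\<Sum>i\<in>UNIV. coord i * (coord i * f))"
    by (simp add: rsq_eq_sum power2_eq_square sum_distrib_right mult.assoc)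
  then show ?thesis using assms by (simp add: homogeneous_sum homogeneous_coord_mult)
qed

lemma homogeneous_rsq_power_mult:
  assumes "homogeneous_polynomial d f"
  shows "homogeneous_polynomial (d + 2 * k) (rsq ^ k * f)"
proof (induction k)
  case 0
  show "homogeneous_polynomial (d + 2 * 0) (rsq ^ 0 * f)" using assms by simp
next
  case (Suc k)
  from homogeneous_rsq_mult[OF this] show "homogeneous_polynomial (d + 2 * Suc k) (rsq ^ Suc k * f)"
    by (simp add: mult.assoc)
qed

text \<open>
  A graded induction principle. Identities for differential operators need to be checked only for
  constants and for their behaviour under sums and under multiplication by one coordinate.
\<close>
lemma homogeneous_polynomial_induct [consumes 1, case_names const add coord]:
  assumes hp: "homogeneous_polynomial d q"
    and const: "\<And>c. Q 0 (\<lambda>_. c)"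
    and add: "\<And>d f g. \<lbrakk>homogeneous_polynomial d f; homogeneous_polynomial d g; Q d f; Q d g\<rbrakk>
                \<Longrightarrow> Q d (f + g)"
    and coord: "\<And>d f i. \<lbrakk>homogeneous_polynomial d f; Q d f\<rbrakk> \<Longrightarrow> Q (Suc d) (coord i * f)"
  shows "Q d (q :: real^'n::finite \<Rightarrow> complex)"
proof -
  have scaled_monomial: "Q d (cscale c (monomial \<alpha>))" if "\<alpha> \<in> exponents d" for c \<alpha> d
    using that
  proof (induction d arbitrary: \<alpha>)
    case 0
    then show ?case using const[of c] by (simp add: exponents_0 monomial_0 cscale_def one_fun_apply)
  next
    case (Suc d)
    then obtain i \<beta> where \<beta>: "\<beta> \<in> exponents d" "\<alpha> = \<beta>(i := \<beta> i + 1)"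
      by (meson exponents_Suc_cases)
    have "cscale c (monomial \<alpha>) = coord i * cscale c (monomial \<beta>)"
      using monomial_incr[of \<beta> i 1] \<beta>(2) by (simp add: cscale_eq_times algebra_simps)
    then show ?case using coord Suc.IH[OF \<beta>(1)] \<beta>(1) by (simp add: homogeneous_scale homogeneous_monomial)
  qed
  have zero: "Q d 0" for d
  proof (induction d)
    case 0 then show ?case using const[of 0] by (simp add: zero_fun_def)
  next
    case (Suc d) then show ?case using coord[OF homogeneous_0, of d undefined] by simp
  qed
  obtain c where q: "q = (\<Sum>\<alpha>\<in>exponents d. cscale (c \<alpha>) (monomial \<alpha>))"
    using hp homogeneous_polynomial_iff by blast
  have "Q d (\<Sum>\<alpha>\<in>A. cscale (c \<alpha>) (monomial \<alpha>))" if "finite A" "A \<subseteq> exponents d" for A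
    using that
    by (induction rule: finite_induct)
       (auto simp: zero intro!: add scaled_monomial homogeneous_sum homogeneous_scale homogeneous_monomial)
  then show ?thesis using q finite_exponents by blast
qed

section \<open>Partial derivatives and the Laplacian on homogeneous polynomials\<close>

text \<open>
  \<^const>\<open>partial_deriv\<close> is a total function and says nothing where the derivative fails to exist. The
  relation below includes existence, which the sum and product rules need.
\<close>
definition has_partial :: "'n::finite \<Rightarrow> (real^'n \<Rightarrow> complex) \<Rightarrow> (real^'n \<Rightarrow> complex) \<Rightarrow> bool" where
  "has_partial i f g \<longleftrightarrow>
     (\<forall>x. ((\<lambda>t. f (x + t *\<^sub>R axis i 1)) has_vector_derivative g x) (at 0))"

lemma has_partial_imp: "has_partial i f g \<Longrightarrow> partial_deriv i f = g"
  by (auto simp: has_partial_def partial_deriv_def fun_eq_iff intro!: vector_derivative_at)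

lemma has_partial_const: "has_partial i (\<lambda>_. c) 0"
  by (simp add: has_partial_def zero_fun_def)

lemma has_partial_add:
  "has_partial i f f' \<Longrightarrow> has_partial i g g' \<Longrightarrow> has_partial i (f + g) (f' + g')"
  by (auto simp: has_partial_def plus_fun_apply intro!: has_vector_derivative_add)

lemma has_partial_mult:
  assumes "has_partial i f f'" "has_partial i g g'"
  shows "has_partial i (f * g) (f' * g + f * g')"
  unfolding has_partial_def
proof
  fix x
  from assms have "((\<lambda>t. f (x + t *\<^sub>R axis i 1) * g (x + t *\<^sub>R axis i 1)) has_vector_derivative
      f (x + 0 *\<^sub>R axis i 1) * g' x + f' x * g (x + 0 *\<^sub>R axis i 1)) (at 0)"
    by (intro has_vector_derivative_mult) (auto simp: has_partial_def)
  then show "((\<lambda>t. (f * g) (x + t *\<^sub>R axis i 1)) has_vector_derivative (f' * g + f * g') x) (at 0)"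
    by (simp add: add.commute fun_apply_simps)
qed

lemma has_partial_coord: "has_partial i (coord j) (if i = j then 1 else 0)"
proof -
  have "((\<lambda>t. complex_of_real (x $ j + t * axis i 1 $ j)) has_vector_derivative
          complex_of_real (axis i 1 $ j)) (at 0)" for x :: "real^'a"
    by (rule has_vector_derivative_of_real)
      (auto intro!: derivative_eq_intros simp: has_real_derivative_iff_has_vector_derivative[symmetric])
  moreover have "complex_of_real (axis i 1 $ j) = (if i = j then 1 else 0) x" for x :: "real^'a"
    by (simp add: axis_def fun_apply_simps)
  ultimately show ?thesis
    unfolding has_partial_def coord_def
    by (simp only: vector_add_component vector_scaleR_component real_scaleR_def) simp
qed

text \<open>
  The case \<open>d = 0\<close> is singled out because of the truncated degree \<open>d - 1\<close>: without the vanishing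
  of the derivative, a coordinate times the derivative would have the wrong degree.
\<close>
lemma homogeneous_partial:
  assumes "homogeneous_polynomial d f"
  shows "has_partial i f (partial_deriv i f) \<and> homogeneous_polynomial (d - 1) (partial_deriv i f)
    \<and> (d = 0 \<longrightarrow> partial_deriv i f = 0)" (is "?P d f")
  using assms
proof (induction rule: homogeneous_polynomial_induct)
  case (const c)
  show "?P 0 (\<lambda>_. c)"
    using has_partial_imp[OF has_partial_const, of i c] has_partial_const[of i c] homogeneous_0
    by metis
next
  case (add d f g)
  then have *: "has_partial i (f + g) (partial_deriv i f + partial_deriv i g)"
    by (intro has_partial_add) auto
  show "?P d (f + g)" using has_partial_imp[OF *] * add by (auto intro!: homogeneous_add)
next
  case (coord d f j)
  then have *: "has_partial i (coord j * f) ((if i = j then 1 else 0) * f + coord j * partial_deriv i f)"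
    by (intro has_partial_mult has_partial_coord) auto
  have "homogeneous_polynomial d (coord j * partial_deriv i f)"
    using coord homogeneous_coord_mult[of "d - 1" "partial_deriv i f" j]
    by (cases d) (simp_all add: homogeneous_0)
  then have "homogeneous_polynomial d ((if i = j then 1 else 0) * f + coord j * partial_deriv i f)"
    using coord by (intro homogeneous_add) (simp_all add: homogeneous_0)
  then show "?P (Suc d) (coord j * f)" using has_partial_imp[OF *] * by simp
qed

lemma homogeneous_partial_deriv: "homogeneous_polynomial d f \<Longrightarrow> homogeneous_polynomial (d - 1) (partial_deriv i f)"
  and homogeneous_has_partial: "homogeneous_polynomial d f \<Longrightarrow> has_partial i f (partial_deriv i f)"
  and homogeneous_partial_deriv_0: "homogeneous_polynomial 0 f \<Longrightarrow> partial_deriv i f = 0"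
  using homogeneous_partial by blast+

lemma partial_deriv_add:
  "homogeneous_polynomial d f \<Longrightarrow> homogeneous_polynomial e g \<Longrightarrow>
    partial_deriv i (f + g) = partial_deriv i f + partial_deriv i g"
  by (intro has_partial_imp has_partial_add homogeneous_has_partial)

lemma partial_deriv_mult:
  "homogeneous_polynomial d f \<Longrightarrow> homogeneous_polynomial e g \<Longrightarrow>
    partial_deriv i (f * g) = partial_deriv i f * g + f * partial_deriv i g"
  by (intro has_partial_imp has_partial_mult homogeneous_has_partial)

lemma partial_deriv_const [simp]: "partial_deriv i (\<lambda>_. c) = 0"
  by (intro has_partial_imp has_partial_const)

lemma partial_deriv_0 [simp]: "partial_deriv i 0 = 0"
  using partial_deriv_const[of i 0] by (simp add: zero_fun_def)

lemma homogeneous_const: "homogeneous_polynomial 0 (\<lambda>_. c)"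
  using homogeneous_scale[OF homogeneous_monomial[of "\<lambda>_. 0" 0], of c]
  by (simp add: exponents_0 monomial_0 cscale_def one_fun_apply)

lemma homogeneous_coord: "homogeneous_polynomial 1 (coord i)"
  using homogeneous_coord_mult[OF homogeneous_const[of 1], of i] by (simp flip: one_fun_def)

lemma partial_deriv_scale:
  "homogeneous_polynomial d f \<Longrightarrow> partial_deriv i (cscale c f) = cscale c (partial_deriv i f)"
  unfolding cscale_eq_times
  by (subst partial_deriv_mult) (auto intro: homogeneous_const simp: partial_deriv_const)

lemma homogeneous_1: "homogeneous_polynomial 0 1"
  using homogeneous_const[of 1] by (simp add: one_fun_def)

lemma partial_deriv_coord_mult:
  "homogeneous_polynomial d f \<Longrightarrow>
    partial_deriv i (coord j * f) = (if i = j then f else 0) + coord j * partial_deriv i f"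
  using has_partial_imp[OF has_partial_coord, of i j]
  by (subst partial_deriv_mult[OF homogeneous_coord]) auto

lemma partial_deriv_sum:
  assumes "\<And>a. a \<in> A \<Longrightarrow> homogeneous_polynomial d (f a)"
  shows "partial_deriv i (\<Sum>a\<in>A. f a) = (\<Sum>a\<in>A. partial_deriv i (f a))"
  using assms
proof (induction A rule: infinite_finite_induct)
  case (insert a A)
  then show "partial_deriv i (sum f (insert a A)) = (\<Sum>a\<in>insert a A. partial_deriv i (f a))"
    by (simp add: partial_deriv_add[of d _ d] homogeneous_sum)
qed simp_all

lemma partial_deriv_rsq_mult:
  assumes "homogeneous_polynomial d f"
  shows "partial_deriv i (rsq * f) = 2 * (coord i * f) + rsq * partial_deriv i f"
proof -
  have "rsq * f = (\<Sum>j\<in>UNIV. coord j * (coord j * f))"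
    by (simp add: rsq_eq_sum power2_eq_square sum_distrib_right mult.assoc)
  then have "partial_deriv i (rsq * f) = (\<Sum>j\<in>UNIV. partial_deriv i (coord j * (coord j * f)))"
    using assms by (simp add: partial_deriv_sum[where d = "Suc (Suc d)"] homogeneous_coord_mult)
  also have "\<dots> = (\<Sum>j\<in>UNIV. (if i = j then 2 * (coord j * f) else 0) + coord j ^ 2 * partial_deriv i f)"
    by (intro sum.cong refl)
      (simp add: partial_deriv_coord_mult[OF homogeneous_coord_mult[OF assms]]
          partial_deriv_coord_mult[OF assms],
        simp add: algebra_simps power2_eq_square)
  also have "\<dots> = 2 * (coord i * f) + rsq * partial_deriv i f"
    by (simp add: sum.distrib rsq_eq_sum sum_distrib_right)
  finally show ?thesis .
qed

lemma partial_deriv_commute: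
  assumes "homogeneous_polynomial d f"
  shows "partial_deriv i (partial_deriv j f) = partial_deriv j (partial_deriv i f)"
  using assms
proof (induction rule: homogeneous_polynomial_induct)
  case (const c)
  show "partial_deriv i (partial_deriv j (\<lambda>_. c)) = partial_deriv j (partial_deriv i (\<lambda>_. c))" by simp
next
  case (add d f g)
  then show "partial_deriv i (partial_deriv j (f + g)) = partial_deriv j (partial_deriv i (f + g))"
    by (simp only: partial_deriv_add[of d _ d] partial_deriv_add[of "d - 1" _ "d - 1"] homogeneous_partial_deriv)
next
  case (coord d f k)
  have *: "partial_deriv i (partial_deriv j (coord k * f))
    = (if j = k then partial_deriv i f else 0) + ((if i = k then partial_deriv j f else 0)
       + coord k * partial_deriv i (partial_deriv j f))" for i j
  proof -
    have "homogeneous_polynomial (Suc (d - 1)) (coord k * partial_deriv j f)"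
      by (intro homogeneous_coord_mult homogeneous_partial_deriv coord)
    moreover have "homogeneous_polynomial d (if j = k then f else 0)"
      using coord by (simp add: homogeneous_0)
    ultimately show ?thesis
      using partial_deriv_coord_mult[OF homogeneous_partial_deriv[OF coord(1)]]
      by (simp add: partial_deriv_coord_mult[OF coord(1)] partial_deriv_add partial_deriv_0)
  qed
  show "partial_deriv i (partial_deriv j (coord k * f)) = partial_deriv j (partial_deriv i (coord k * f))"
    unfolding *[of i j] *[of j i] using coord by (simp add: algebra_simps)
qed

text \<open>
  Euler's identity is what makes the commutator of the Laplacian with \<open>|x|\<^sup>2\<close> a scalar in each
  degree (\<open>laplacian_rsq_mult\<close>).
\<close>
lemma euler_identity:
  assumes "homogeneous_polynomial d f"
  shows "(\<Sum>i\<in>UNIV. coord i * partial_deriv i f) = of_nat d * f"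
    (is "?P d f")
  using assms
proof (induction rule: homogeneous_polynomial_induct)
  case (const c)
  show "?P 0 (\<lambda>_. c)" by simp
next
  case (add d f g)
  then show "?P d (f + g)"
    by (simp add: partial_deriv_add[of d _ d] algebra_simps sum.distrib)
next
  case (coord d f k)
  have "(\<Sum>i\<in>UNIV. coord i * partial_deriv i (coord k * f)) =
     (\<Sum>i\<in>UNIV. (if i = k then coord i * f else 0) + coord k * (coord i * partial_deriv i f))"
    by (intro sum.cong refl) (simp add: partial_deriv_coord_mult[OF coord(1)], simp add: algebra_simps)
  also have "\<dots> = coord k * f + coord k * (of_nat d * f)"
    using coord by (simp add: sum.distrib flip: sum_distrib_left)
  finally show "?P (Suc d) (coord k * f)" by (simp add: algebra_simps)
qed

lemma laplacian_eq_sum: "laplacian f = (\<Sum>i\<in>UNIV. partial_deriv i (partial_deriv i f))"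
  by (rule ext) (simp add: laplacian_def sum_fun_apply)

lemma homogeneous_laplacian: "homogeneous_polynomial d f \<Longrightarrow> homogeneous_polynomial (d - 2) (laplacian f)"
  unfolding laplacian_eq_sum
  by (rule homogeneous_sum)
    (use homogeneous_partial_deriv[OF homogeneous_partial_deriv, of d f] in \<open>simp add: numeral_2_eq_2\<close>)

lemma laplacian_add:
  assumes "homogeneous_polynomial d f" "homogeneous_polynomial d g"
  shows "laplacian (f + g) = laplacian f + laplacian g"
proof -
  have "partial_deriv i (partial_deriv i (f + g))
      = partial_deriv i (partial_deriv i f) + partial_deriv i (partial_deriv i g)" for i
    using assms by (simp only: partial_deriv_add[of d _ d]
        partial_deriv_add[of "d - 1" _ "d - 1"] homogeneous_partial_deriv)
  then show ?thesis by (simp only: laplacian_eq_sum sum.distrib)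
qed

lemma laplacian_scale:
  assumes "homogeneous_polynomial d f"
  shows "laplacian (cscale c f) = cscale c (laplacian f)"
proof -
  have "partial_deriv i (partial_deriv i (cscale c f)) = cscale c (partial_deriv i (partial_deriv i f))"
    for i
    using assms by (simp only: partial_deriv_scale[of d] partial_deriv_scale[of "d - 1"] homogeneous_partial_deriv)
  then show ?thesis by (simp only: laplacian_eq_sum cfun.scale_sum_right)
qed

lemma laplacian_0: "laplacian 0 = 0"
  by (simp add: laplacian_eq_sum)

lemma laplacian_1: "laplacian 1 = 0"
  by (simp add: laplacian_eq_sum one_fun_def)

lemma laplacian_coord_mult:
  assumes "homogeneous_polynomial d f"
  shows "laplacian (coord j * f) = 2 * partial_deriv j f + coord j * laplacian f"
proof -
  have *: "partial_deriv i (partial_deriv i (coord j * f)) =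
      (if i = j then 2 * partial_deriv i f else 0) + coord j * partial_deriv i (partial_deriv i f)" for i
  proof -
    have "homogeneous_polynomial (Suc (d - 1)) (coord j * partial_deriv i f)"
      by (intro homogeneous_coord_mult homogeneous_partial_deriv assms)
    moreover have "homogeneous_polynomial d (if i = j then f else 0)"
      using assms by (simp add: homogeneous_0)
    ultimately show ?thesis
      using partial_deriv_coord_mult[OF homogeneous_partial_deriv[OF assms]]
      by (simp add: partial_deriv_coord_mult[OF assms] partial_deriv_add partial_deriv_0)
  qed
  show ?thesis unfolding laplacian_eq_sum * by (simp add: sum.distrib sum_distrib_left)
qed

lemma laplacian_partial_deriv:
  assumes "homogeneous_polynomial d f"
  shows "laplacian (partial_deriv j f) = partial_deriv j (laplacian f)"
proof -
  have "partial_deriv j (laplacian f) = (\<Sum>i\<in>UNIV. partial_deriv j (partial_deriv i (partial_deriv i f)))"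
    unfolding laplacian_eq_sum using assms
    by (intro partial_deriv_sum[where d = "d - 1 - 1"] homogeneous_partial_deriv)
  also have "\<dots> = laplacian (partial_deriv j f)"
    unfolding laplacian_eq_sum
    using partial_deriv_commute[OF homogeneous_partial_deriv[OF assms]] partial_deriv_commute[OF assms] by simp
  finally show ?thesis ..
qed

text \<open>
  By the product rule \<open>\<Delta>(|x|\<^sup>2 f) = 2 n f + 4 \<Sum> x\<^sub>i \<partial>\<^sub>i f + |x|\<^sup>2 \<Delta>f\<close>, and Euler's identity turns
  the middle term into \<open>4 d f\<close>. The total coefficient \<open>2 n + 4 d\<close> of \<open>f\<close> is positive, which keeps
  iterated Laplacians of \<open>|x|\<^sup>2\<^sup>k H\<close> from vanishing too early.
\<close>
lemma laplacian_rsq_mult: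
  assumes "homogeneous_polynomial d (f :: real^'n::finite \<Rightarrow> complex)"
  shows "laplacian (rsq * f) = of_nat (2 * CARD('n) + 4 * d) * f + rsq * laplacian f"
proof -
  have *: "partial_deriv i (partial_deriv i (rsq * f)) =
      2 * f + 4 * (coord i * partial_deriv i f) + rsq * partial_deriv i (partial_deriv i f)" for i
  proof -
    have two: "2 * (coord i * f) = cscale 2 (coord i * f)"
      by (simp add: cscale_eq_times numeral_fun)
    have "homogeneous_polynomial (d - 1 + 2) (rsq * partial_deriv i f)"
      by (intro homogeneous_rsq_mult homogeneous_partial_deriv assms)
    moreover have "homogeneous_polynomial (Suc d) (cscale 2 (coord i * f))"
      using assms by (intro homogeneous_scale homogeneous_coord_mult)
    ultimately have "partial_deriv i (partial_deriv i (rsq * f)) =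
        cscale 2 (partial_deriv i (coord i * f)) + partial_deriv i (rsq * partial_deriv i f)"
      by (simp add: partial_deriv_rsq_mult[OF assms] two partial_deriv_add
          partial_deriv_scale[OF homogeneous_coord_mult[OF assms]])
    also have "\<dots> = 2 * (f + coord i * partial_deriv i f)
        + (2 * (coord i * partial_deriv i f) + rsq * partial_deriv i (partial_deriv i f))"
      unfolding partial_deriv_coord_mult[OF assms] partial_deriv_rsq_mult[OF homogeneous_partial_deriv[OF assms]]
      by (simp add: cscale_eq_times flip: numeral_fun)
    finally show ?thesis by (simp add: algebra_simps)
  qed
  have "laplacian (rsq * f) = of_nat (2 * CARD('n)) * f
      + 4 * (\<Sum>i\<in>UNIV. coord i * partial_deriv i f) + rsq * laplacian f"
    unfolding laplacian_eq_sum * by (simp add: sum.distrib sum_distrib_left algebra_simps)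
  then show ?thesis unfolding euler_identity[OF assms] by (simp add: algebra_simps)
qed

section \<open>Linear independence of the monomials\<close>

lemma partial_deriv_monomial:
  fixes \<alpha> :: "'n::finite \<Rightarrow> nat"
  shows "partial_deriv i (monomial \<alpha>) = cscale (of_nat (\<alpha> i)) (monomial (\<alpha>(i := \<alpha> i - 1)))"
proof -
  have "partial_deriv i (monomial \<alpha>) = cscale (of_nat (\<alpha> i)) (monomial (\<alpha>(i := \<alpha> i - 1)))"
    if "\<alpha> \<in> exponents d" for d
    using that
  proof (induction d arbitrary: \<alpha>)
    case 0
    then have "\<alpha> = (\<lambda>_. 0)" by (simp add: exponents_0)
    then show ?case by (simp add: monomial_0 one_fun_def)
  next
    case (Suc d)
    then obtain j \<beta> where \<beta>: "\<beta> \<in> exponents d" "\<alpha> = \<beta>(j := \<beta> j + 1)"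
      by (meson exponents_Suc_cases)
    have m: "monomial \<alpha> = coord j * monomial \<beta>"
      using monomial_incr[of \<beta> j 1] \<beta>(2) by simp
    have pd: "partial_deriv i (monomial \<alpha>) = (if i = j then monomial \<beta> else 0)
        + coord j * cscale (of_nat (\<beta> i)) (monomial (\<beta>(i := \<beta> i - 1)))"
      unfolding m partial_deriv_coord_mult[OF homogeneous_monomial[OF \<beta>(1)]] Suc.IH[OF \<beta>(1)] ..
    show ?case
    proof (cases "i = j")
      case True
      have "coord j * cscale (of_nat (\<beta> i)) (monomial (\<beta>(i := \<beta> i - 1))) = cscale (of_nat (\<beta> i)) (monomial \<beta>)"
      proof (cases "\<beta> i = 0")
        case False
        then show ?thesis using monomial_incr[of "\<beta>(i := \<beta> i - 1)" i 1] True
          by (simp add: cscale_eq_times mult.left_commute)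
      qed (simp add: True)
      moreover have "\<alpha>(i := \<alpha> i - 1) = \<beta>" "\<alpha> i = \<beta> i + 1" using True \<beta>(2) by auto
      ultimately show ?thesis unfolding pd using True by (simp add: cfun.scale_left_distrib)
    next
      case False
      have "coord j * monomial (\<beta>(i := \<beta> i - 1)) = monomial (\<alpha>(i := \<alpha> i - 1))"
        using monomial_incr[of "\<beta>(i := \<beta> i - 1)" j 1] False \<beta>(2) by (simp add: fun_upd_twist)
      moreover have "\<alpha> i = \<beta> i" using False \<beta>(2) by simp
      ultimately show ?thesis unfolding pd using False
        by (simp only: cscale_eq_times mult.left_commute[of "coord j"] if_False add_0_left)
    qed
  qed
  then show ?thesis by (simp add: exponents_def)
qed

text \<open>
  Induction on the degree. Differentiating a vanishing combination in \<open>x\<^sub>i\<close> gives a vanishing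
  combination one degree lower, whose coefficients are those of the monomials containing \<open>x\<^sub>i\<close>,
  multiplied by nonzero exponents; every monomial of positive degree contains some \<open>x\<^sub>i\<close>.
\<close>
lemma monomial_coefficients_eq_0:
  fixes \<beta> :: "'n::finite \<Rightarrow> nat"
  assumes "(\<Sum>\<alpha>\<in>exponents d. cscale (c \<alpha>) (monomial \<alpha>)) = 0" and "\<beta> \<in> exponents d"
  shows "c \<beta> = 0"
  using assms
proof (induction d arbitrary: c \<beta>)
  case 0
  then have "cscale (c \<beta>) 1 = 0" by (simp add: exponents_0 monomial_0)
  then show ?case using fun_cong[of "cscale (c \<beta>) 1" 0 undefined]
    by (simp add: cscale_def fun_apply_simps)
next
  case (Suc d)
  obtain i \<gamma> where \<gamma>: "\<gamma> \<in> exponents d" "\<beta> = \<gamma>(i := \<gamma> i + 1)"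
    using Suc.prems(2) by (meson exponents_Suc_cases)
  let ?up = "\<lambda>\<gamma>. \<gamma>(i := \<gamma> i + 1)"
  let ?t = "\<lambda>\<alpha>. cscale (c \<alpha> * of_nat (\<alpha> i)) (monomial (\<alpha>(i := \<alpha> i - 1)))"
  have inj: "inj_on ?up (exponents d)"
  proof (rule inj_onI)
    fix x y :: "'n \<Rightarrow> nat" assume "?up x = ?up y"
    then have "(?up x) j = (?up y) j" for j by simp
    then show "x = y" by (metis (no_types, lifting) add_right_cancel ext fun_upd_apply)
  qed
  have "0 = partial_deriv i (\<Sum>\<alpha>\<in>exponents (Suc d). cscale (c \<alpha>) (monomial \<alpha>))"
    using Suc.prems(1) by simp
  also have "\<dots> = (\<Sum>\<alpha>\<in>exponents (Suc d). ?t \<alpha>)"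
    by (subst partial_deriv_sum[where d = "Suc d"])
      (auto intro!: homogeneous_scale homogeneous_monomial sum.cong
        simp: partial_deriv_scale[OF homogeneous_monomial] partial_deriv_monomial)
  \<comment> \<open>Only exponents with \<open>\<alpha> i > 0\<close> survive, and these are the images under \<open>?up\<close>.\<close>
  also have "\<dots> = (\<Sum>\<alpha>\<in>?up ` exponents d. ?t \<alpha>)"
  proof (rule sum.mono_neutral_right[OF finite_exponents])
    show "?up ` exponents d \<subseteq> exponents (Suc d)"
      using exponents_incr[of _ i 1 d] by auto
    show "\<forall>\<alpha>\<in>exponents (Suc d) - ?up ` exponents d. ?t \<alpha> = 0"
    proof
      fix \<alpha> assume \<alpha>: "\<alpha> \<in> exponents (Suc d) - ?up ` exponents d"
      have "\<alpha> i = 0"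
      proof (rule ccontr)
        assume "\<alpha> i \<noteq> 0"
        then have "\<alpha> = ?up (\<alpha>(i := \<alpha> i - 1))" by auto
        moreover from this have "\<alpha>(i := \<alpha> i - 1) \<in> exponents d"
          using exponents_incr[of "\<alpha>(i := \<alpha> i - 1)" i 1 d] \<alpha> by simp
        ultimately show False using \<alpha> by blast
      qed
      then show "?t \<alpha> = 0" by simp
    qed
  qed
  also have "\<dots> = (\<Sum>\<gamma>\<in>exponents d. cscale (c (?up \<gamma>) * of_nat (\<gamma> i + 1)) (monomial \<gamma>))"
    by (subst sum.reindex[OF inj]) (auto intro!: sum.cong)
  finally have "(\<Sum>\<gamma>\<in>exponents d. cscale (c (?up \<gamma>) * of_nat (\<gamma> i + 1)) (monomial \<gamma>)) = 0" ..
  from Suc.IH[OF this \<gamma>(1)] have "c (?up \<gamma>) = 0"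
    by (metis add.commute mult_eq_0_iff of_nat_eq_0_iff add_is_0 one_neq_zero)
  then show ?case using \<gamma>(2) by (simp only:)
qed

lemma inj_on_monomial: "inj_on monomial (exponents d)"
proof (rule inj_onI, rule ccontr)
  fix \<alpha> \<beta> :: "'a \<Rightarrow> nat"
  assume \<alpha>\<beta>: "\<alpha> \<in> exponents d" "\<beta> \<in> exponents d" "monomial \<alpha> = monomial \<beta>" "\<alpha> \<noteq> \<beta>"
  define c :: "('a \<Rightarrow> nat) \<Rightarrow> complex"
    where "c \<gamma> = (if \<gamma> = \<alpha> then 1 else 0) - (if \<gamma> = \<beta> then 1 else 0)" for \<gamma>
  have "(\<Sum>\<gamma>\<in>exponents d. cscale (c \<gamma>) (monomial \<gamma>))
     = (\<Sum>\<gamma>\<in>exponents d. (if \<gamma> = \<alpha> then monomial \<gamma> else 0) - (if \<gamma> = \<beta> then monomial \<gamma> else 0))"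
    by (intro sum.cong) (auto simp: c_def)
  also have "\<dots> = monomial \<alpha> - monomial \<beta>"
    using \<alpha>\<beta>(1,2) finite_exponents[where 'n = 'a] by (simp only: sum_subtractf sum.delta if_True)
  finally have "(\<Sum>\<gamma>\<in>exponents d. cscale (c \<gamma>) (monomial \<gamma>)) = 0" using \<alpha>\<beta>(3) by simp
  from monomial_coefficients_eq_0[OF this \<alpha>\<beta>(1)] \<alpha>\<beta>(4) show False by (simp add: c_def)
qed

lemma independent_monomials: "cfun.independent (monomial ` exponents d)"
proof -
  have "u (monomial \<alpha>) = 0"
    if "(\<Sum>v\<in>monomial ` exponents d. cscale (u v) v) = 0" "\<alpha> \<in> exponents d"
    for u and \<alpha> :: "'a \<Rightarrow> nat"
    using that monomial_coefficients_eq_0[of "\<lambda>\<alpha>. u (monomial \<alpha>)" d \<alpha>]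
    by (simp add: sum.reindex[OF inj_on_monomial])
  then show ?thesis
    by (subst cfun.dependent_finite) (auto simp: finite_exponents)
qed

section \<open>Multiples of the squared norm\<close>

text \<open>
  The degree \<open>d\<close> part of the ideal generated by \<open>|x|\<^sup>2\<close>. Writing it as a span with the condition
  \<open>\<dots> + 2 = d\<close> makes it zero for \<open>d < 2\<close> without truncated subtraction.
\<close>
definition radial_multiples :: "nat \<Rightarrow> (real^'n::finite \<Rightarrow> complex) set" where
  "radial_multiples d = cfun.span {rsq * monomial \<beta> | \<beta>. (\<Sum>i\<in>UNIV. \<beta> i) + 2 = d}"

lemma subspace_radial_multiples: "cfun.subspace (radial_multiples d)"
  by (simp add: radial_multiples_def)

lemma span_times_mono:
  assumes "f \<in> cfun.span B" and "\<And>b. b \<in> B \<Longrightarrow> g * b \<in> cfun.span C"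
  shows "g * f \<in> cfun.span (C :: ('a \<Rightarrow> complex) set)"
  using assms(1)
proof (induction rule: cfun.span_induct_alt)
  case base
  show "g * 0 \<in> cfun.span C" by (simp add: cfun.span_zero)
next
  case (step c x y)
  have "g * (cscale c x + y) = cscale c (g * x) + g * y"
    by (simp add: cscale_eq_times algebra_simps)
  then show "g * (cscale c x + y) \<in> cfun.span C"
    using step assms(2) by (simp add: cfun.span_add cfun.span_scale)
qed

lemma rsq_mult_in_radial_multiples:
  assumes "homogeneous_polynomial d f"
  shows "rsq * f \<in> radial_multiples (d + 2)"
  unfolding radial_multiples_def
proof (rule span_times_mono)
  show "f \<in> cfun.span (monomial ` exponents d)" using assms homogeneous_eq_span_monomials by blast
qed (auto intro!: cfun.span_base simp: exponents_def)

lemma coord_mult_in_radial_multiples: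
  assumes "f \<in> radial_multiples d"
  shows "coord i * f \<in> radial_multiples (Suc d)"
  unfolding radial_multiples_def
proof (rule span_times_mono)
  show "f \<in> cfun.span {rsq * monomial \<beta> | \<beta>. (\<Sum>i\<in>UNIV. \<beta> i) + 2 = d}"
    using assms by (simp add: radial_multiples_def)
next
  fix b :: "real^'a \<Rightarrow> complex"
  assume "b \<in> {rsq * monomial \<beta> | \<beta>. (\<Sum>i\<in>UNIV. \<beta> i) + 2 = d}"
  then obtain \<beta> where \<beta>: "b = rsq * monomial \<beta>" "(\<Sum>i\<in>UNIV. \<beta> i) + 2 = d" by blast
  let ?\<beta> = "\<beta>(i := \<beta> i + 1)"
  have "coord i * b = rsq * monomial ?\<beta>"
    using \<beta>(1) monomial_incr[of \<beta> i 1] by (simp add: mult.left_commute)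
  moreover have "(\<Sum>j\<in>UNIV. ?\<beta> j) + 2 = Suc d"
    using \<beta>(2) sum_fun_upd[of \<beta> i "\<beta> i + 1"] by linarith
  ultimately show "coord i * b \<in> cfun.span {rsq * monomial \<beta> | \<beta>. (\<Sum>i\<in>UNIV. \<beta> i) + 2 = Suc d}"
    by (intro cfun.span_base) blast
qed

section \<open>Iterated Laplacians of powers of the squared norm times a harmonic polynomial\<close>

lemma laplacian_power_0: "(laplacian ^^ p) 0 = 0"
  by (induction p) (simp_all add: laplacian_0)

lemma laplacian_power_linear:
  assumes "homogeneous_polynomial d f"
  shows "homogeneous_polynomial (d - 2 * p) ((laplacian ^^ p) f)"
    and "(laplacian ^^ p) (cscale c f) = cscale c ((laplacian ^^ p) f)"
    and "homogeneous_polynomial d g \<Longrightarrow>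
      (laplacian ^^ p) (f + g) = (laplacian ^^ p) f + (laplacian ^^ p) g"
proof -
  have hp: "homogeneous_polynomial (d - 2 * p) ((laplacian ^^ p) f)"
    if "homogeneous_polynomial d f" for f p
  proof (induction p)
    case (Suc p)
    from homogeneous_laplacian[OF Suc] show ?case by (simp add: algebra_simps)
  qed (use that in simp)
  show "homogeneous_polynomial (d - 2 * p) ((laplacian ^^ p) f)" using hp assms .
  show "(laplacian ^^ p) (cscale c f) = cscale c ((laplacian ^^ p) f)"
    by (induction p) (simp_all add: laplacian_scale[OF hp[OF assms]])
  show "(laplacian ^^ p) (f + g) = (laplacian ^^ p) f + (laplacian ^^ p) g"
    if "homogeneous_polynomial d g"
    by (induction p) (simp_all add: laplacian_add[OF hp[OF assms] hp[OF that]])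
qed

lemma polyharmonic_homogeneous_iff:
  "q \<in> polyharmonic_homogeneous m p \<longleftrightarrow> homogeneous_polynomial m q \<and> (laplacian ^^ p) q = 0"
  by (simp add: polyharmonic_homogeneous_def zero_fun_def)

lemma subspace_polyharmonic_homogeneous: "cfun.subspace (polyharmonic_homogeneous m p)"
  by (rule cfun.subspaceI)
    (auto simp: polyharmonic_homogeneous_iff homogeneous_0 homogeneous_add homogeneous_scale
        laplacian_power_0 laplacian_power_linear)

lemma of_nat_times_fun: "of_nat c * f = cscale (of_nat c) (f :: 'a \<Rightarrow> complex)"
  by (simp add: cscale_eq_times of_nat_fun)

lemma laplacian_rsq_power_mult:
  assumes hp: "homogeneous_polynomial d (H :: real^'n::finite \<Rightarrow> complex)" and harm: "laplacian H = 0"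
  shows "\<exists>C>0. laplacian (rsq ^ Suc k * H) = cscale (of_nat C) (rsq ^ k * H)"
proof (induction k)
  case 0
  show ?case
    using laplacian_rsq_mult[OF hp] harm
    by (intro exI[of _ "2 * CARD('n) + 4 * d"])
      (simp add: of_nat_times_fun del: of_nat_add of_nat_mult)
next
  case (Suc k)
  then obtain C where C: "laplacian (rsq ^ Suc k * H) = cscale (of_nat C) (rsq ^ k * H)" by blast
  have sum_of_nat: "of_nat A * F + of_nat C * F = cscale (of_nat (A + C)) F"
    for A and F :: "real^'n \<Rightarrow> complex"
    by (simp add: of_nat_times_fun cfun.scale_left_distrib)
  have "laplacian (rsq ^ Suc (Suc k) * H) = laplacian (rsq * (rsq ^ Suc k * H))"
    by (simp add: mult.assoc)
  also have "\<dots> = of_nat (2 * CARD('n) + 4 * (d + 2 * Suc k)) * (rsq ^ Suc k * H)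
      + rsq * cscale (of_nat C) (rsq ^ k * H)"
    unfolding laplacian_rsq_mult[OF homogeneous_rsq_power_mult[OF hp]] C ..
  also have "rsq * cscale (of_nat C) (rsq ^ k * H) = of_nat C * (rsq ^ Suc k * H)"
    by (simp add: of_nat_times_fun[symmetric] algebra_simps)
  also have "of_nat (2 * CARD('n) + 4 * (d + 2 * Suc k)) * (rsq ^ Suc k * H) + of_nat C * (rsq ^ Suc k * H)
      = cscale (of_nat (2 * CARD('n) + 4 * (d + 2 * Suc k) + C)) (rsq ^ Suc k * H)"
    by (rule sum_of_nat)
  finally show ?case by (intro exI[of _ "2 * CARD('n) + 4 * (d + 2 * Suc k) + C"]) simp
qed

text \<open>
  Each Laplacian removes one factor \<open>|x|\<^sup>2\<close> at the cost of a nonzero constant, so \<open>\<Delta>\<^sup>k\<close> recovers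
  \<open>H\<close> from \<open>|x|\<^sup>2\<^sup>k H\<close>. This separates the layers of a polynomial \<open>\<Sum> |x|\<^sup>2\<^sup>k H\<^sub>k\<close>.
\<close>
lemma laplacian_power_rsq_power_mult:
  assumes hp: "homogeneous_polynomial d H" and harm: "laplacian H = 0"
  shows "\<exists>C. C \<noteq> 0 \<and> (laplacian ^^ k) (rsq ^ k * H) = cscale C H"
proof (induction k)
  case 0
  show ?case by (intro exI[of _ 1]) simp
next
  case (Suc k)
  then obtain C where C: "C \<noteq> 0" "(laplacian ^^ k) (rsq ^ k * H) = cscale C H" by blast
  obtain D where D: "D > 0" "laplacian (rsq ^ Suc k * H) = cscale (of_nat D) (rsq ^ k * H)"
    using laplacian_rsq_power_mult[OF hp harm] by blast
  have "(laplacian ^^ Suc k) (rsq ^ Suc k * H) = (laplacian ^^ k) (cscale (of_nat D) (rsq ^ k * H))"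
    unfolding funpow_Suc_right comp_def D(2) ..
  also have "\<dots> = cscale (of_nat D) (cscale C H)"
    unfolding laplacian_power_linear(2)[OF homogeneous_rsq_power_mult[OF hp]] C(2) ..
  finally show ?case using C(1) D(1) by (intro exI[of _ "of_nat D * C"]) simp
qed

lemma rsq_power_mult_polyharmonic:
  assumes hp: "homogeneous_polynomial d H" and harm: "laplacian H = 0" and "k < p"
  shows "rsq ^ k * H \<in> polyharmonic_homogeneous (d + 2 * k) p"
proof -
  obtain C where C: "(laplacian ^^ k) (rsq ^ k * H) = cscale C H"
    using laplacian_power_rsq_power_mult[OF hp harm] by blast
  have "(laplacian ^^ Suc k) (rsq ^ k * H) = 0"
    by (simp add: C laplacian_scale[OF hp] harm)
  moreover obtain j where "p = j + Suc k"
    using \<open>k < p\<close> by (metis add.commute less_iff_Suc_add add_Suc_right)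
  ultimately have "(laplacian ^^ p) (rsq ^ k * H) = 0"
    by (simp only: funpow_add comp_def laplacian_power_0)
  then show ?thesis by (simp add: polyharmonic_homogeneous_iff homogeneous_rsq_power_mult[OF hp])
qed

section \<open>Bases from harmonic polynomials with prescribed leading monomials\<close>

text \<open>
  The common core of both parts. The monomials with exponent at most one in \<open>x\<^sub>i\<^sub>0\<close> represent the
  polynomials modulo \<open>|x|\<^sup>2\<close>, since \<open>|x|\<^sup>2\<close> is monic of degree two in \<open>x\<^sub>i\<^sub>0\<close>; the family
  provides a harmonic representative, up to a scalar, of each of their classes.
\<close>
locale triangular_harmonic_family =
  fixes i0 :: "'n::finite" and h :: "('n \<Rightarrow> nat) \<Rightarrow> real^'n \<Rightarrow> complex"
  assumes homogeneous: "\<And>d \<alpha>. \<alpha> i0 \<le> 1 \<Longrightarrow> \<alpha> \<in> exponents d \<Longrightarrow> homogeneous_polynomial d (h \<alpha>)"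
    and harmonic: "\<And>\<alpha>. \<alpha> i0 \<le> 1 \<Longrightarrow> laplacian (h \<alpha>) = 0"
    and triangular: "\<And>d \<alpha>. \<alpha> i0 \<le> 1 \<Longrightarrow> \<alpha> \<in> exponents d \<Longrightarrow>
      \<exists>c. c \<noteq> 0 \<and> h \<alpha> - cscale c (monomial \<alpha>) \<in> radial_multiples d"
begin

definition family :: "nat \<Rightarrow> nat \<Rightarrow> (real^'n \<Rightarrow> complex) set" where
  "family m p = {rsq ^ k * h \<alpha> | k \<alpha>. (\<Sum>i\<in>UNIV. \<alpha> i) + 2 * k = m \<and> \<alpha> i0 \<le> 1 \<and> k < p}"

lemma family_subset_polyharmonic: "family m p \<subseteq> polyharmonic_homogeneous m p"
  using homogeneous harmonic rsq_power_mult_polyharmonic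
  by (fastforce simp: family_def exponents_def)

lemma span_family_subset_polyharmonic: "cfun.span (family m p) \<subseteq> polyharmonic_homogeneous m p"
  by (rule cfun.span_minimal[OF family_subset_polyharmonic subspace_polyharmonic_homogeneous])

lemma radial_multiples_subset_span_family:
  assumes "\<And>d q. d < m \<Longrightarrow> homogeneous_polynomial d q \<Longrightarrow> q \<in> cfun.span (family d (Suc d))"
  shows "radial_multiples m \<subseteq> cfun.span (family m (Suc m))"
  unfolding radial_multiples_def
proof (rule cfun.span_minimal[OF _ cfun.subspace_span], clarify)
  fix \<beta> :: "'n \<Rightarrow> nat"
  assume m: "m = (\<Sum>i\<in>UNIV. \<beta> i) + 2"
  let ?d = "\<Sum>i\<in>UNIV. \<beta> i"
  have "monomial \<beta> \<in> cfun.span (family ?d (Suc ?d))"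
    using m by (intro assms homogeneous_monomial) (simp_all add: exponents_def)
  then show "rsq * monomial \<beta> \<in> cfun.span (family (?d + 2) (Suc (?d + 2)))"
  proof (rule span_times_mono)
    fix b assume "b \<in> family ?d (Suc ?d)"
    then obtain k \<alpha> where b: "b = rsq ^ k * h \<alpha>" "(\<Sum>i\<in>UNIV. \<alpha> i) + 2 * k = ?d" "\<alpha> i0 \<le> 1"
      by (auto simp: family_def)
    have "rsq * b = rsq ^ Suc k * h \<alpha>" using b(1) by (simp add: mult.assoc)
    moreover have "(\<Sum>i\<in>UNIV. \<alpha> i) + 2 * Suc k = ?d + 2" "Suc k < Suc (?d + 2)" using b(2) by simp_all
    ultimately show "rsq * b \<in> cfun.span (family (?d + 2) (Suc (?d + 2)))"
      using b(3) unfolding family_def by (intro cfun.span_base) blast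
  qed
qed

text \<open>
  Division by \<open>x\<^sub>i\<^sub>0\<^sup>2 = |x|\<^sup>2 - \<Sum>\<^sub>j x\<^sub>j\<^sup>2\<close> (sum over \<open>j \<noteq> i0\<close>): as long as the exponent of
  \<open>x\<^sub>i\<^sub>0\<close> is at least two, the monomial is replaced by monomials with smaller exponent there,
  modulo \<open>|x|\<^sup>2\<close>. Once the exponent is at most one, the monomial is a multiple of a member of the
  family, again modulo \<open>|x|\<^sup>2\<close>.
\<close>
lemma monomial_in_span_family:
  assumes radial: "radial_multiples m \<subseteq> cfun.span (family m (Suc m))"
    and "\<alpha> \<in> exponents m"
  shows "monomial \<alpha> \<in> cfun.span (family m (Suc m))"
  using \<open>\<alpha> \<in> exponents m\<close>
proof (induction "\<alpha> i0" arbitrary: \<alpha> rule: less_induct)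
  case less
  show ?case
  proof (cases "\<alpha> i0 \<le> 1")
    case True
    obtain c where c: "c \<noteq> 0" "h \<alpha> - cscale c (monomial \<alpha>) \<in> cfun.span (family m (Suc m))"
      using triangular[OF True less.prems] radial by blast
    have "rsq ^ 0 * h \<alpha> \<in> family m (Suc m)"
      unfolding family_def using True less.prems by (force simp: exponents_def)
    then have "h \<alpha> \<in> cfun.span (family m (Suc m))" by (simp add: cfun.span_base)
    from cfun.span_diff[OF this c(2)] have "cscale c (monomial \<alpha>) \<in> cfun.span (family m (Suc m))"
      by simp
    from cfun.span_scale[OF this, of "inverse c"] c(1) show ?thesis by simp
  next
    case False
    define \<beta> where "\<beta> = \<alpha>(i0 := \<alpha> i0 - 2)"
    have \<alpha>: "\<alpha> = \<beta>(i0 := \<beta> i0 + 2)" using False by (simp add: \<beta>_def fun_eq_iff)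
    obtain d where m: "m = d + 2" and \<beta>: "\<beta> \<in> exponents d"
    proof -
      have "m = (\<Sum>i\<in>UNIV. \<beta> i) + 2"
        using less.prems sum_fun_upd[of \<beta> i0 "\<beta> i0 + 2"] \<alpha> by (simp add: exponents_def)
      then show ?thesis using that by (simp add: exponents_def)
    qed
    have "rsq * monomial \<beta> = (\<Sum>j\<in>UNIV. monomial (\<beta>(j := \<beta> j + 2)))"
      by (simp only: rsq_eq_sum sum_distrib_right monomial_incr)
    also have "\<dots> = monomial \<alpha> + (\<Sum>j\<in>UNIV - {i0}. monomial (\<beta>(j := \<beta> j + 2)))"
      by (subst sum.remove[of _ i0]) (simp_all only: \<alpha>[symmetric] finite_class.finite UNIV_I)
    finally have "monomial \<alpha> = rsq * monomial \<beta> - (\<Sum>j\<in>UNIV - {i0}. monomial (\<beta>(j := \<beta> j + 2)))"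
      by simp
    moreover have "rsq * monomial \<beta> \<in> cfun.span (family m (Suc m))"
      using radial rsq_mult_in_radial_multiples[OF homogeneous_monomial[OF \<beta>]] m by blast
    moreover have "(\<Sum>j\<in>UNIV - {i0}. monomial (\<beta>(j := \<beta> j + 2))) \<in> cfun.span (family m (Suc m))"
    proof (rule cfun.span_sum)
      fix j assume "j \<in> UNIV - {i0}"
      then have "(\<beta>(j := \<beta> j + 2)) i0 < \<alpha> i0" using \<alpha> False by (auto simp: \<beta>_def)
      moreover have "\<beta>(j := \<beta> j + 2) \<in> exponents m"
        using \<beta> m exponents_incr[of \<beta> j 2 d] by simp
      ultimately show "monomial (\<beta>(j := \<beta> j + 2)) \<in> cfun.span (family m (Suc m))"
        by (rule less.hyps)
    qed
    ultimately show ?thesis by (simp only: cfun.span_diff)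
  qed
qed

lemma homogeneous_polynomial_in_span_family:
  assumes "homogeneous_polynomial m q"
  shows "q \<in> cfun.span (family m (Suc m))"
  using assms
proof (induction m arbitrary: q rule: less_induct)
  case (less m)
  have "monomial ` exponents m \<subseteq> cfun.span (family m (Suc m))"
    using monomial_in_span_family[OF radial_multiples_subset_span_family[OF less.IH]] by blast
  from cfun.span_minimal[OF this cfun.subspace_span] show ?case
    using less.prems homogeneous_eq_span_monomials by blast
qed

text \<open>
  Independence by counting. The map \<open>(k, \<alpha>) \<mapsto> \<alpha> + 2 k e\<^sub>i\<^sub>0\<close> from indices to multi-indices of
  degree \<open>m\<close> is injective, because the parity of the new exponent recovers the old one, which is
  at most one. So the family has at most as many members as there are monomials of degree \<open>m\<close>;
  these are independent and lie in its span, and a spanning set of minimal size is independent.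
\<close>
lemma independent_family_all: "cfun.independent (family m (Suc m))"
proof -
  define I :: "(nat \<times> ('n \<Rightarrow> nat)) set" where "I = {(k, \<alpha>). (\<Sum>i\<in>UNIV. \<alpha> i) + 2 * k = m \<and> \<alpha> i0 \<le> 1}"
  define \<phi> :: "nat \<times> ('n \<Rightarrow> nat) \<Rightarrow> 'n \<Rightarrow> nat" where "\<phi> = (\<lambda>(k, \<alpha>). \<alpha>(i0 := \<alpha> i0 + 2 * k))"
  have inj: "inj_on \<phi> I"
  proof (rule inj_onI, clarify)
    fix k \<alpha> l \<beta>
    assume I: "(k, \<alpha>) \<in> I" "(l, \<beta>) \<in> I" and eq: "\<phi> (k, \<alpha>) = \<phi> (l, \<beta>)"
    have *: "\<alpha> j = \<beta> j" if "j \<noteq> i0" for j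
      using fun_cong[OF eq, of j] that by (simp add: \<phi>_def)
    have "\<alpha> i0 + 2 * k = \<beta> i0 + 2 * l"
      using fun_cong[OF eq, of i0] by (simp add: \<phi>_def)
    moreover have "\<alpha> i0 \<le> 1" "\<beta> i0 \<le> 1" using I by (auto simp: I_def)
    ultimately have "\<alpha> i0 = \<beta> i0" "k = l" by presburger+
    then show "k = l \<and> \<alpha> = \<beta>" using * by (metis ext)
  qed
  have sub: "\<phi> ` I \<subseteq> exponents m"
  proof clarify
    fix k \<alpha> assume "(k, \<alpha>) \<in> I"
    then show "\<phi> (k, \<alpha>) \<in> exponents m"
      using sum_fun_upd[of \<alpha> i0 "\<alpha> i0 + 2 * k"] by (simp add: I_def \<phi>_def exponents_def)
  qed
  have finI: "finite I" using inj sub finite_exponents finite_imageD finite_subset by metis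
  have family: "family m (Suc m) = (\<lambda>(k, \<alpha>). rsq ^ k * h \<alpha>) ` I"
  proof -
    have "k < Suc m" if "(\<Sum>i\<in>UNIV. \<alpha> i) + 2 * k = m" for k and \<alpha> :: "'n \<Rightarrow> nat"
      using that by linarith
    then show ?thesis unfolding family_def I_def by fast
  qed
  have fin: "finite (family m (Suc m))" using finI family by simp
  have "card (family m (Suc m)) \<le> card I" unfolding family by (rule card_image_le[OF finI])
  also have "\<dots> \<le> card (exponents m :: ('n \<Rightarrow> nat) set)"
    using card_inj_on_le[OF inj sub finite_exponents] .
  also have "\<dots> = card (monomial ` (exponents m :: ('n \<Rightarrow> nat) set))"
    by (simp add: card_image[OF inj_on_monomial])
  finally have card: "card (family m (Suc m)) \<le> card (monomial ` (exponents m :: ('n \<Rightarrow> nat) set))" .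
  obtain B where B: "B \<subseteq> family m (Suc m)" "cfun.independent B" "family m (Suc m) \<subseteq> cfun.span B"
    using cfun.maximal_independent_subset by metis
  have "monomial ` exponents m \<subseteq> cfun.span (family m (Suc m))"
    using homogeneous_polynomial_in_span_family homogeneous_monomial by blast
  also have "\<dots> \<subseteq> cfun.span B" using B(3) by (simp add: cfun.span_minimal)
  finally have "card (monomial ` (exponents m :: ('n \<Rightarrow> nat) set)) \<le> card B"
    using cfun.independent_span_bound[OF finite_subset[OF B(1) fin] independent_monomials] by blast
  then have "B = family m (Suc m)" using card card_subset_eq[OF fin B(1)] card_mono[OF fin B(1)] by simp
  then show ?thesis using B(2) by simp
qed

lemma independent_family: "cfun.independent (family m p)"
proof (rule cfun.independent_mono[OF independent_family_all])
  show "family m p \<subseteq> family m (Suc m)" unfolding family_def by fastforce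
qed

text \<open>
  On the span of the first \<open>K + 1\<close> layers, \<open>\<Delta>\<^sup>K\<close> kills the lower ones and maps the top layer
  \<open>|x|\<^sup>2\<^sup>K H\<close> to a nonzero multiple of \<open>H\<close>.
\<close>
lemma top_layer_vanishes:
  assumes "q \<in> cfun.span (family m (Suc K))" and "(laplacian ^^ K) q = 0"
  shows "q \<in> cfun.span (family m K)"
proof -
  let ?G = "{rsq ^ K * h \<alpha> | \<alpha>. (\<Sum>i\<in>UNIV. \<alpha> i) + 2 * K = m \<and> \<alpha> i0 \<le> 1}"
  have "family m (Suc K) = family m K \<union> ?G" unfolding family_def less_Suc_eq by blast
  then obtain q' r where q: "q = q' + r" "q' \<in> cfun.span (family m K)" "r \<in> cfun.span ?G"
    using assms(1) by (auto simp: cfun.span_Un)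
  \<comment> \<open>For \<open>m < 2 * K\<close> the top layer is empty; the last clause keeps the degrees right there.\<close>
  let ?S = "{rsq ^ K * H | H. H \<in> polyharmonic_homogeneous (m - 2 * K) 1 \<and> (m < 2 * K \<longrightarrow> H = 0)}
    :: (real^'n \<Rightarrow> complex) set"
  have "cfun.span ?G \<subseteq> ?S"
  proof (rule cfun.span_minimal)
    show "?G \<subseteq> ?S"
      using homogeneous harmonic by (fastforce simp: polyharmonic_homogeneous_iff exponents_def)
    note sub = subspace_polyharmonic_homogeneous[of "m - 2 * K" 1]
    show "cfun.subspace ?S"
    proof (rule cfun.subspaceI)
      show "0 \<in> ?S" using cfun.subspace_0[OF sub] by force
    next
      fix x y :: "real^'n \<Rightarrow> complex" assume "x \<in> ?S" "y \<in> ?S"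
      then obtain H H' where
        "x = rsq ^ K * H" "H \<in> polyharmonic_homogeneous (m - 2 * K) 1" "m < 2 * K \<longrightarrow> H = 0"
        "y = rsq ^ K * H'" "H' \<in> polyharmonic_homogeneous (m - 2 * K) 1" "m < 2 * K \<longrightarrow> H' = 0" by blast
      then show "x + y \<in> ?S" using cfun.subspace_add[OF sub, of H H']
        by (intro CollectI exI[of _ "H + H'"]) (simp add: distrib_left)
    next
      fix c and x :: "real^'n \<Rightarrow> complex" assume "x \<in> ?S"
      then obtain H where
        "x = rsq ^ K * H" "H \<in> polyharmonic_homogeneous (m - 2 * K) 1" "m < 2 * K \<longrightarrow> H = 0" by blast
      then show "cscale c x \<in> ?S" using cfun.subspace_scale[OF sub, of H c]
        by (intro CollectI exI[of _ "cscale c H"]) (simp add: cscale_eq_times mult.left_commute)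
    qed
  qed
  then obtain H where r: "r = rsq ^ K * H" and hp: "homogeneous_polynomial (m - 2 * K) H"
    and harm: "laplacian H = 0" and deg: "m < 2 * K \<longrightarrow> H = 0"
    using q(3) by (auto simp: polyharmonic_homogeneous_iff)
  have "H = 0"
  proof (cases "m < 2 * K")
    case False
    have "q' \<in> polyharmonic_homogeneous m K"
      using q(2) span_family_subset_polyharmonic by blast
    then have q': "homogeneous_polynomial m q'" "(laplacian ^^ K) q' = 0"
      by (simp_all add: polyharmonic_homogeneous_iff)
    have "homogeneous_polynomial m r"
      using homogeneous_rsq_power_mult[OF hp, of K] False r by simp
    then have "(laplacian ^^ K) r = 0"
      using laplacian_power_linear(3)[OF q'(1), of r K] q'(2) assms(2) q(1) by simp
    moreover obtain C where "C \<noteq> 0" "(laplacian ^^ K) r = cscale C H"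
      using laplacian_power_rsq_power_mult[OF hp harm] r by blast
    ultimately show ?thesis using cfun.scale_eq_0_iff by metis
  qed (use deg in simp)
  then show ?thesis using q r by simp
qed

text \<open>
  A polyharmonic polynomial of order \<open>p\<close> is annihilated by \<open>\<Delta>\<^sup>K\<close> for every \<open>K \<ge> p\<close>, so the layers
  from \<open>p\<close> upwards can be peeled off one at a time, starting from the top.
\<close>
lemma polyharmonic_in_span_family:
  assumes "p \<le> K" and "q \<in> cfun.span (family m K)" and "(laplacian ^^ p) q = 0"
  shows "q \<in> cfun.span (family m p)"
  using assms
proof (induction K rule: dec_induct)
  case (step K)
  have "(laplacian ^^ K) q = (laplacian ^^ (K - p)) ((laplacian ^^ p) q)"
    using step.hyps by (metis comp_apply funpow_add le_add_diff_inverse2)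
  then show ?case using step top_layer_vanishes by (simp add: laplacian_power_0)
qed

theorem family_is_basis: "is_basis_of (family m p) (polyharmonic_homogeneous m p)"
  unfolding is_basis_of_def
proof (intro conjI independent_family subset_antisym span_family_subset_polyharmonic subsetI)
  fix q :: "real^'n \<Rightarrow> complex" assume q: "q \<in> polyharmonic_homogeneous m p"
  then have "q \<in> cfun.span (family m (Suc m))" and z: "(laplacian ^^ p) q = 0"
    by (simp_all add: polyharmonic_homogeneous_iff homogeneous_polynomial_in_span_family)
  \<comment> \<open>The order \<open>p\<close> may exceed the number of nonempty layers.\<close>
  moreover have "family m (Suc m) \<subseteq> family m (max p (Suc m))" unfolding family_def by fastforce
  ultimately have "q \<in> cfun.span (family m (max p (Suc m)))" using cfun.span_mono by blast
  from polyharmonic_in_span_family[OF _ this z] show "q \<in> cfun.span (family m p)" by simp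
qed

end

section \<open>The plane: real and imaginary parts of powers\<close>

lemma partial_deriv_diff:
  assumes "homogeneous_polynomial d f" "homogeneous_polynomial d g"
  shows "partial_deriv i (f - g) = partial_deriv i f - partial_deriv i g"
  using partial_deriv_add[OF homogeneous_diff[OF assms] assms(2), of i] by (simp add: algebra_simps)

lemma laplacian_diff:
  assumes "homogeneous_polynomial d f" "homogeneous_polynomial d g"
  shows "laplacian (f - g) = laplacian f - laplacian g"
  using laplacian_add[OF homogeneous_diff[OF assms] assms(2)] by (simp add: algebra_simps)

lemmas radial_multiples_add = cfun.subspace_add[OF subspace_radial_multiples]
  and radial_multiples_diff = cfun.subspace_diff[OF subspace_radial_multiples]
  and radial_multiples_scale = cfun.subspace_scale[OF subspace_radial_multiples]
  and radial_multiples_0 = cfun.subspace_0[OF subspace_radial_multiples]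

definition z_re :: "nat \<Rightarrow> real^2 \<Rightarrow> complex" where
  "z_re d x = complex_of_real (Re (Complex (x $ 1) (x $ 2) ^ d))"

definition z_im :: "nat \<Rightarrow> real^2 \<Rightarrow> complex" where
  "z_im d x = complex_of_real (Im (Complex (x $ 1) (x $ 2) ^ d))"

lemma z_re_0: "z_re 0 = 1" and z_im_0: "z_im 0 = 0"
  by (simp_all add: fun_eq_iff z_re_def z_im_def fun_apply_simps)

lemma z_re_Suc: "z_re (Suc d) = coord 1 * z_re d - coord 2 * z_im d"
  and z_im_Suc: "z_im (Suc d) = coord 2 * z_re d + coord 1 * z_im d"
  by (simp_all add: fun_eq_iff z_re_def z_im_def fun_apply_simps coord_def)

lemma homogeneous_z: "homogeneous_polynomial d (z_re d)" "homogeneous_polynomial d (z_im d)"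
proof (induction d)
  case 0
  show "homogeneous_polynomial 0 (z_re 0)" "homogeneous_polynomial 0 (z_im 0)"
    by (simp_all add: z_re_0 z_im_0 homogeneous_0 homogeneous_1)
next
  case (Suc d)
  then show "homogeneous_polynomial (Suc d) (z_re (Suc d))" "homogeneous_polynomial (Suc d) (z_im (Suc d))"
    by (simp_all add: z_re_Suc z_im_Suc homogeneous_diff homogeneous_add homogeneous_coord_mult)
qed

text \<open>
  The Cauchy-Riemann equations, obtained from the recursion for the powers of \<open>x\<^sub>1 + i x\<^sub>2\<close>. They
  make the first-order terms in \<open>\<Delta>\<close> of that recursion cancel.
\<close>
lemma cauchy_riemann:
  "partial_deriv 1 (z_re d) = partial_deriv 2 (z_im d)"
  "partial_deriv 2 (z_re d) = - partial_deriv 1 (z_im d)"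
proof (induction d)
  case 0
  have "partial_deriv i (z_re 0) = 0" "partial_deriv i (z_im 0) = 0" for i
    using homogeneous_partial_deriv_0[OF homogeneous_z(1)[of 0]]
      homogeneous_partial_deriv_0[OF homogeneous_z(2)[of 0]] by blast+
  then show "partial_deriv 1 (z_re 0) = partial_deriv 2 (z_im 0)"
    "partial_deriv 2 (z_re 0) = - partial_deriv 1 (z_im 0)"
    by simp_all
next
  case (Suc d)
  note [simp] = z_re_Suc z_im_Suc
    partial_deriv_diff[OF homogeneous_coord_mult[OF homogeneous_z(1)] homogeneous_coord_mult[OF homogeneous_z(2)]]
    partial_deriv_add[OF homogeneous_coord_mult[OF homogeneous_z(1)] homogeneous_coord_mult[OF homogeneous_z(2)]]
    partial_deriv_coord_mult[OF homogeneous_z(1)] partial_deriv_coord_mult[OF homogeneous_z(2)]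
  show "partial_deriv 1 (z_re (Suc d)) = partial_deriv 2 (z_im (Suc d))"
    "partial_deriv 2 (z_re (Suc d)) = - partial_deriv 1 (z_im (Suc d))"
    using Suc by simp_all
qed

lemma laplacian_z: "laplacian (z_re d) = 0" "laplacian (z_im d) = 0"
proof (induction d)
  case 0
  show "laplacian (z_re 0) = 0" "laplacian (z_im 0) = 0"
    by (simp_all add: z_re_0 z_im_0 laplacian_0 laplacian_1)
next
  case (Suc d)
  show "laplacian (z_re (Suc d)) = 0" "laplacian (z_im (Suc d)) = 0"
    unfolding z_re_Suc z_im_Suc
      laplacian_diff[OF homogeneous_coord_mult[OF homogeneous_z(1)] homogeneous_coord_mult[OF homogeneous_z(2)]]
      laplacian_add[OF homogeneous_coord_mult[OF homogeneous_z(1)] homogeneous_coord_mult[OF homogeneous_z(2)]]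
      laplacian_coord_mult[OF homogeneous_z(1)] laplacian_coord_mult[OF homogeneous_z(2)]
    by (simp_all add: Suc cauchy_riemann)
qed

lemma homogeneous_coord_power: "homogeneous_polynomial d (coord i ^ d)"
proof (induction d)
  case 0 show ?case by (simp add: homogeneous_1)
next
  case (Suc d) then show ?case by (simp add: homogeneous_coord_mult)
qed

text \<open>
  Modulo \<open>|x|\<^sup>2\<close> one has \<open>x\<^sub>2\<^sup>2 = - x\<^sub>1\<^sup>2\<close>. Hence in \<open>(x\<^sub>1 + i x\<^sub>2)\<^sup>d\<^sup>+\<^sup>1\<close> all terms with an even
  power of \<open>x\<^sub>2\<close> become positive multiples of \<open>x\<^sub>1\<^sup>d\<^sup>+\<^sup>1\<close>, those with an odd power become \<open>i\<close>
  times positive multiples of \<open>x\<^sub>1\<^sup>d x\<^sub>2\<close>, and the binomial coefficients add up to \<open>2\<^sup>d\<close> in both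
  cases.
\<close>
lemma z_triangular:
  "z_re (Suc d) - cscale (2 ^ d) (coord 1 ^ Suc d) \<in> radial_multiples (Suc d)"
  "z_im (Suc d) - cscale (2 ^ d) (coord 1 ^ d * coord 2) \<in> radial_multiples (Suc d)"
proof (induction d)
  case 0
  show "z_re (Suc 0) - cscale (2 ^ 0) (coord 1 ^ Suc 0) \<in> radial_multiples (Suc 0)"
    "z_im (Suc 0) - cscale (2 ^ 0) (coord 1 ^ 0 * coord 2) \<in> radial_multiples (Suc 0)"
    by (simp_all add: z_re_Suc z_im_Suc z_re_0 z_im_0 radial_multiples_0)
next
  case (Suc d)
  let ?R = "z_re (Suc d) - cscale (2 ^ d) (coord 1 ^ Suc d)"
  let ?I = "z_im (Suc d) - cscale (2 ^ d) (coord 1 ^ d * coord 2)"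
  let ?c = "(\<lambda>_. 2 ^ d) :: real^2 \<Rightarrow> complex"
  have two: "(\<lambda>_. 2 ^ Suc d) = 2 * ?c"
    by (simp add: fun_eq_iff fun_apply_simps)
  have rsq: "rsq = coord (1 :: 2) ^ 2 + coord 2 ^ 2"
    by (simp add: rsq_eq_sum sum_2)
  have rad: "cscale (2 ^ d) (rsq * coord (1 :: 2) ^ d) \<in> radial_multiples (Suc (Suc d))"
    using rsq_mult_in_radial_multiples[OF homogeneous_coord_power[of d "1 :: 2"]]
    by (simp add: radial_multiples_scale)
  have "z_re (Suc (Suc d)) - cscale (2 ^ Suc d) (coord 1 ^ Suc (Suc d))
      = coord 1 * ?R - coord 2 * ?I - cscale (2 ^ d) (rsq * coord 1 ^ d)"
    unfolding z_re_Suc[of "Suc d"] cscale_eq_times two rsq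
    by (simp add: algebra_simps power2_eq_square)
  then show "z_re (Suc (Suc d)) - cscale (2 ^ Suc d) (coord 1 ^ Suc (Suc d)) \<in> radial_multiples (Suc (Suc d))"
    using Suc rad by (simp only: radial_multiples_diff coord_mult_in_radial_multiples)
  have "z_im (Suc (Suc d)) - cscale (2 ^ Suc d) (coord 1 ^ Suc d * coord 2) = coord 2 * ?R + coord 1 * ?I"
    unfolding z_im_Suc[of "Suc d"] cscale_eq_times two
    by (simp add: algebra_simps)
  then show "z_im (Suc (Suc d)) - cscale (2 ^ Suc d) (coord 1 ^ Suc d * coord 2) \<in> radial_multiples (Suc (Suc d))"
    using Suc by (simp only: radial_multiples_add coord_mult_in_radial_multiples)
qed

lemma rsq_power_apply: "(rsq ^ k) x = complex_of_real (norm x ^ (2 * k))"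
  by (simp add: power_fun_apply rsq_def power_mult)

lemma v_re_eq: "v_re m k = rsq ^ k * z_re (m - 2 * k)"
  and v_im_eq: "v_im m k = rsq ^ k * z_im (m - 2 * k)"
  by (simp_all add: fun_eq_iff v_re_def v_im_def times_fun_apply rsq_power_apply z_re_def z_im_def)

text \<open>
  With exponent at most one in \<open>x\<^sub>2\<close>, the multi-indices of degree \<open>d\<close> are \<open>(d, 0)\<close> and, for
  \<open>d > 0\<close>, \<open>(d - 1, 1)\<close>: these are the leading monomials of the real and the imaginary part.
\<close>
definition planar_harmonic :: "(2 \<Rightarrow> nat) \<Rightarrow> real^2 \<Rightarrow> complex" where
  "planar_harmonic \<alpha> = (if \<alpha> 2 = 0 then z_re (\<alpha> 1 + \<alpha> 2) else z_im (\<alpha> 1 + \<alpha> 2))"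

lemma monomial_2: "monomial \<alpha> = coord (1 :: 2) ^ \<alpha> 1 * coord 2 ^ \<alpha> 2"
  by (rule ext) (simp add: monomial_apply times_fun_apply power_fun_apply UNIV_2)

interpretation planar: triangular_harmonic_family 2 planar_harmonic
proof
  fix d and \<alpha> :: "2 \<Rightarrow> nat"
  assume "\<alpha> \<in> exponents d"
  then show "homogeneous_polynomial d (planar_harmonic \<alpha>)"
    by (auto simp: planar_harmonic_def exponents_def sum_2 homogeneous_z)
next
  fix \<alpha> :: "2 \<Rightarrow> nat"
  show "laplacian (planar_harmonic \<alpha>) = 0"
    by (simp add: planar_harmonic_def laplacian_z)
next
  fix d and \<alpha> :: "2 \<Rightarrow> nat"
  assume le: "\<alpha> 2 \<le> 1" and d: "\<alpha> \<in> exponents d"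
  show "\<exists>c. c \<noteq> 0 \<and> planar_harmonic \<alpha> - cscale c (monomial \<alpha>) \<in> radial_multiples d"
  proof (cases d)
    case 0
    then show ?thesis using d
      by (intro exI[of _ 1])
        (simp add: exponents_0 planar_harmonic_def monomial_0 z_re_0 radial_multiples_0)
  next
    case (Suc e)
    have "planar_harmonic \<alpha> - cscale (2 ^ e) (monomial \<alpha>) \<in> radial_multiples d"
    proof (cases "\<alpha> 2 = 0")
      case True
      then show ?thesis using z_triangular(1)[of e] d Suc
        by (simp add: planar_harmonic_def monomial_2 exponents_def sum_2)
    next
      case False
      then have "\<alpha> 2 = 1" "\<alpha> 1 = e" using le d Suc by (simp_all add: exponents_def sum_2)
      then show ?thesis using z_triangular(2)[of e] Suc
        by (simp add: planar_harmonic_def monomial_2)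
    qed
    then show ?thesis by (intro exI[of _ "2 ^ e"]) simp
  qed
qed

lemma planar_family_eq:
  "planar.family m p = {v_re m k | k. k < p \<and> 2 * k \<le> m} \<union> {v_im m k | k. k < p \<and> 2 * k < m}"
  (is "_ = ?R \<union> ?I")
proof
  show "planar.family m p \<subseteq> ?R \<union> ?I"
  proof
    fix f assume "f \<in> planar.family m p"
    then obtain k \<alpha> where f: "f = rsq ^ k * planar_harmonic \<alpha>" and m: "\<alpha> 1 + \<alpha> 2 + 2 * k = m"
      and "\<alpha> 2 \<le> 1" "k < p"
      by (auto simp: planar.family_def sum_2)
    from m have deg: "m - 2 * k = \<alpha> 1 + \<alpha> 2" by simp
    show "f \<in> ?R \<union> ?I"
    proof (cases "\<alpha> 2 = 0")
      case True
      then have "f = v_re m k" by (simp add: f v_re_eq planar_harmonic_def deg)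
      then show ?thesis using \<open>k < p\<close> m by auto
    next
      case False
      then have "f = v_im m k" by (simp add: f v_im_eq planar_harmonic_def deg)
      moreover have "2 * k < m" using m False by simp
      ultimately show ?thesis using \<open>k < p\<close> by blast
    qed
  qed
  have "v_re m k \<in> planar.family m p" if "k < p" "2 * k \<le> m" for k
    unfolding planar.family_def v_re_eq
    using that
    by (intro CollectI exI[of _ k] exI[of _ "\<lambda>i::2. if i = 1 then m - 2 * k else 0"])
      (simp add: planar_harmonic_def sum_2)
  moreover have "v_im m k \<in> planar.family m p" if "k < p" "2 * k < m" for k
    unfolding planar.family_def v_im_eq
    using that
    by (intro CollectI exI[of _ k] exI[of _ "\<lambda>i::2. if i = 1 then m - 2 * k - 1 else 1"])
      (simp add: planar_harmonic_def sum_2 Suc_diff_Suc)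
  ultimately show "?R \<union> ?I \<subseteq> planar.family m p" by blast
qed

section \<open>Higher dimensions: derivatives of the Newtonian kernel\<close>

lemma norm_powi_has_derivative:
  fixes x :: "real^'n::finite"
  assumes "x \<noteq> 0"
  shows "((\<lambda>t. norm (x + t *\<^sub>R axis i 1) powi s) has_real_derivative
           of_int s * x $ i * norm x powi (s - 2)) (at 0)"
proof -
  have sq: "norm (x + t *\<^sub>R axis i 1) = sqrt ((norm x)\<^sup>2 + 2 * t * x $ i + t\<^sup>2)" for t
    by (simp add: norm_eq_sqrt_inner inner_add_left inner_add_right
        inner_axis inner_axis' algebra_simps power2_eq_square)
  have "((\<lambda>t. sqrt ((norm x)\<^sup>2 + 2 * t * x $ i + t\<^sup>2)) has_real_derivative x $ i / norm x) (at 0)"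
    using assms by (auto intro!: derivative_eq_intros simp: field_simps)
  then have "((\<lambda>t. norm (x + t *\<^sub>R axis i 1)) has_real_derivative x $ i / norm x) (at 0)"
    by (simp add: sq)
  from DERIV_power_int[OF this, of s]
  have "((\<lambda>t. norm (x + t *\<^sub>R axis i 1) powi s) has_real_derivative
      of_int s * norm x powi (s - 1) * (x $ i / norm x)) (at 0)"
    using assms by simp
  moreover have "norm x powi (s - 1) = norm x powi (s - 2) * norm x"
    using power_int_add_1[of "norm x" "s - 2"] assms by simp
  ultimately show ?thesis using assms by (simp add: field_simps)
qed

lemma partial_deriv_norm_powi_mult:
  fixes h :: "real^'n::finite \<Rightarrow> complex"
  assumes hp: "homogeneous_polynomial d h"
    and f: "\<And>y. y \<noteq> 0 \<Longrightarrow> f y = complex_of_real (norm y powi s) * h y"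
    and x: "x \<noteq> 0"
  shows "partial_deriv i f x
    = complex_of_real (norm x powi (s - 2)) * (cscale (of_int s) (coord i * h) + rsq * partial_deriv i h) x"
proof -
  let ?l = "\<lambda>t. x + t *\<^sub>R axis i 1"
  have "((\<lambda>t. complex_of_real (norm (?l t) powi s) * h (?l t)) has_vector_derivative
      complex_of_real (norm (?l 0) powi s) * partial_deriv i h x
      + complex_of_real (of_int s * x $ i * norm x powi (s - 2)) * h (?l 0)) (at 0)"
    using norm_powi_has_derivative[OF x] homogeneous_has_partial[OF hp, of i]
    by (intro has_vector_derivative_mult has_vector_derivative_of_real)
      (auto simp: has_partial_def has_real_derivative_iff_has_vector_derivative[symmetric])
  moreover have "open {t. ?l t \<noteq> 0}"
    by (intro open_Collect_neq continuous_intros)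
  ultimately have "((\<lambda>t. f (?l t)) has_vector_derivative
      complex_of_real (norm (?l 0) powi s) * partial_deriv i h x
      + complex_of_real (of_int s * x $ i * norm x powi (s - 2)) * h (?l 0)) (at 0)"
    by (rule has_vector_derivative_transform_within_open) (use f x in auto)
  then have "partial_deriv i f x = complex_of_real (norm x powi s) * partial_deriv i h x
      + complex_of_real (of_int s * x $ i * norm x powi (s - 2)) * h x"
    unfolding partial_deriv_def by (simp add: vector_derivative_at)
  moreover have "norm x powi s = norm x powi (s - 2) * (norm x)\<^sup>2"
    using power_int_add[of "norm x" "s - 2" 2] x by simp
  ultimately show ?thesis
    by (simp add: fun_apply_simps cscale_def coord_def rsq_def algebra_simps)
qed

text \<open>
  If \<open>f = |x|\<^sup>s h\<close> with \<open>s = 2 - n - 2 d\<close>, then \<open>\<partial>\<^sub>i f = |x|\<^sup>s\<^sup>-\<^sup>2 h'\<close> for the following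
  polynomial \<open>h'\<close>.
\<close>
definition newtonian_step :: "nat \<Rightarrow> 'n::finite \<Rightarrow> (real^'n \<Rightarrow> complex) \<Rightarrow> real^'n \<Rightarrow> complex" where
  "newtonian_step d i h = cscale (of_int (2 - int CARD('n) - 2 * int d)) (coord i * h) + rsq * partial_deriv i h"

lemma rsq_partial_deriv_in_radial_multiples:
  assumes "homogeneous_polynomial d h"
  shows "rsq * partial_deriv i h \<in> radial_multiples (Suc d)"
proof (cases d)
  case 0
  then show ?thesis using assms by (simp add: homogeneous_partial_deriv_0 radial_multiples_0)
next
  case (Suc e)
  then show ?thesis using rsq_mult_in_radial_multiples[OF homogeneous_partial_deriv[OF assms, of i]] by simp
qed

lemma radial_multiples_homogeneous: "f \<in> radial_multiples d \<Longrightarrow> homogeneous_polynomial d f"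
proof -
  have "radial_multiples d \<subseteq> {q. homogeneous_polynomial d q}"
    unfolding radial_multiples_def
    by (rule cfun.span_minimal[OF _ subspace_homogeneous])
      (auto intro!: homogeneous_rsq_mult homogeneous_monomial simp: exponents_def simp del: add_2_eq_Suc')
  then show "f \<in> radial_multiples d \<Longrightarrow> homogeneous_polynomial d f" by blast
qed

lemma homogeneous_newtonian_step:
  assumes "homogeneous_polynomial d h"
  shows "homogeneous_polynomial (Suc d) (newtonian_step d i h)"
  unfolding newtonian_step_def
  using assms radial_multiples_homogeneous[OF rsq_partial_deriv_in_radial_multiples[OF assms]]
  by (intro homogeneous_add homogeneous_scale homogeneous_coord_mult)

text \<open>
  Harmonicity survives differentiation of \<open>|x|\<^sup>2\<^sup>-\<^sup>n\<^sup>-\<^sup>2\<^sup>d h\<close> as a purely polynomial fact: the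
  two summands contribute \<open>2 (2 - n - 2 d)\<close> and \<open>2 n + 4 (d - 1)\<close> times \<open>\<partial>\<^sub>i h\<close>, which cancel;
  for \<open>d = 0\<close> the derivative itself is zero.
\<close>
lemma laplacian_newtonian_step:
  fixes h :: "real^'n::finite \<Rightarrow> complex"
  assumes hp: "homogeneous_polynomial d h" and harm: "laplacian h = 0"
  shows "laplacian (newtonian_step d i h) = 0"
proof -
  let ?c = "of_int (2 - int CARD('n) - 2 * int d) :: complex"
  have "laplacian (newtonian_step d i h)
      = cscale ?c (laplacian (coord i * h)) + laplacian (rsq * partial_deriv i h)"
    unfolding newtonian_step_def
    using radial_multiples_homogeneous[OF rsq_partial_deriv_in_radial_multiples[OF hp]]
    by (simp only: laplacian_add[where d = "Suc d"] laplacian_scale[where d = "Suc d"]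
        homogeneous_scale homogeneous_coord_mult hp)
  also have "laplacian (coord i * h) = cscale 2 (partial_deriv i h)"
    using laplacian_coord_mult[OF hp] harm by (simp add: cscale_eq_times numeral_fun)
  also have "laplacian (rsq * partial_deriv i h)
      = cscale (of_nat (2 * CARD('n) + 4 * (d - 1))) (partial_deriv i h)"
    unfolding laplacian_rsq_mult[OF homogeneous_partial_deriv[OF hp]] laplacian_partial_deriv[OF hp] harm
    by (simp only: partial_deriv_0 mult_zero_right add_0_right of_nat_times_fun)
  also have "cscale ?c (cscale 2 (partial_deriv i h)) + \<dots>
      = cscale (?c * 2 + of_nat (2 * CARD('n) + 4 * (d - 1))) (partial_deriv i h)"
    by (simp only: cfun.scale_left_distrib cfun.scale_scale)
  also have "\<dots> = 0"
  proof (cases d)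
    case 0
    then show ?thesis using hp by (simp add: homogeneous_partial_deriv_0)
  next
    case (Suc e)
    then have "?c * 2 + of_nat (2 * CARD('n) + 4 * (d - 1)) = 0" by simp
    then show ?thesis by simp
  qed
  finally show ?thesis .
qed

text \<open>
  The shape \<open>f = |x|\<^sup>2\<^sup>-\<^sup>n\<^sup>-\<^sup>2\<^sup>d h\<close>, \<open>d = |\<alpha>|\<close>, of the derivative \<open>f = D\<^sup>\<alpha> |x|\<^sup>2\<^sup>-\<^sup>n\<close> away from
  the origin, with \<open>h\<close> harmonic and with leading monomial \<open>x\<^sup>\<alpha>\<close>. The value of \<open>f\<close> at the origin
  is left open.
\<close>
definition newtonian_form :: "('n::finite \<Rightarrow> nat) \<Rightarrow> (real^'n \<Rightarrow> complex) \<Rightarrow> (real^'n \<Rightarrow> complex) \<Rightarrow> bool" where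
  "newtonian_form \<alpha> f h \<longleftrightarrow>
     homogeneous_polynomial (\<Sum>i\<in>UNIV. \<alpha> i) h \<and> laplacian h = 0 \<and>
     (\<exists>c. c \<noteq> 0 \<and> h - cscale c (monomial \<alpha>) \<in> radial_multiples (\<Sum>i\<in>UNIV. \<alpha> i)) \<and>
     (\<forall>x. x \<noteq> 0 \<longrightarrow>
       f x = complex_of_real (norm x powi (2 - int CARD('n) - 2 * int (\<Sum>i\<in>UNIV. \<alpha> i))) * h x)"

text \<open>
  The leading coefficient is multiplied by \<open>2 - n - 2 d\<close>, which is nonzero for every \<open>d\<close> since
  \<open>n > 2\<close>; in the plane it would vanish at \<open>d = 0\<close>.
\<close>
lemma newtonian_form_partial_deriv:
  fixes h :: "real^'n::finite \<Rightarrow> complex"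
  assumes n: "2 < CARD('n)" and rf: "newtonian_form \<alpha> f h"
  shows "newtonian_form (\<alpha>(i := \<alpha> i + 1)) (partial_deriv i f) (newtonian_step (\<Sum>i\<in>UNIV. \<alpha> i) i h)"
proof -
  define d where "d = (\<Sum>i\<in>UNIV. \<alpha> i)"
  define s where "s = 2 - int CARD('n) - 2 * int d"
  have deg: "(\<Sum>j\<in>UNIV. (\<alpha>(i := \<alpha> i + 1)) j) = Suc d"
    using sum_fun_upd[of \<alpha> i "\<alpha> i + 1"] by (simp add: d_def)
  have hp: "homogeneous_polynomial d h" and harm: "laplacian h = 0"
    and f: "\<And>x. x \<noteq> 0 \<Longrightarrow> f x = complex_of_real (norm x powi s) * h x"
    using rf by (auto simp: newtonian_form_def d_def s_def)
  obtain c where c: "c \<noteq> 0" "h - cscale c (monomial \<alpha>) \<in> radial_multiples d"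
    using rf by (auto simp: newtonian_form_def d_def)
  have "s \<noteq> 0" using n by (simp add: s_def)
  have "newtonian_step d i h - cscale (of_int s * c) (monomial (\<alpha>(i := \<alpha> i + 1)))
    = cscale (of_int s) (coord i * (h - cscale c (monomial \<alpha>))) + rsq * partial_deriv i h"
    using monomial_incr[of \<alpha> i 1]
    by (simp add: newtonian_step_def s_def[symmetric] right_diff_distrib cfun.scale_right_diff_distrib)
      (simp add: cscale_eq_times fun_eq_iff fun_apply_simps)
  then have tri: "newtonian_step d i h - cscale (of_int s * c) (monomial (\<alpha>(i := \<alpha> i + 1)))
      \<in> radial_multiples (Suc d)"
    using c(2) rsq_partial_deriv_in_radial_multiples[OF hp, of i]
    by (simp only: radial_multiples_add radial_multiples_scale coord_mult_in_radial_multiples)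
  have "partial_deriv i f x = complex_of_real (norm x powi (s - 2)) * newtonian_step d i h x" if "x \<noteq> 0" for x
    using partial_deriv_norm_powi_mult[OF hp f that, of i] by (simp add: newtonian_step_def s_def)
  moreover have "s - 2 = 2 - int CARD('n) - 2 * int (Suc d)" by (simp add: s_def)
  ultimately have "partial_deriv i f x
      = complex_of_real (norm x powi (2 - int CARD('n) - 2 * int (Suc d))) * newtonian_step d i h x" if "x \<noteq> 0" for x
    using that by simp
  moreover have "of_int s * c \<noteq> 0" using \<open>s \<noteq> 0\<close> c(1) by simp
  ultimately show ?thesis
    unfolding newtonian_form_def deg d_def[symmetric]
    using homogeneous_newtonian_step[OF hp] laplacian_newtonian_step[OF hp harm] tri by blast
qed

lemma newtonian_form_foldr:
  fixes f :: "real^'n::finite \<Rightarrow> complex"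
  assumes n: "2 < CARD('n)" and "distinct is" and rf: "newtonian_form (\<lambda>_. 0) f h"
  shows "\<exists>h. newtonian_form (\<lambda>j. if j \<in> set is then \<alpha> j else 0) (foldr (\<lambda>i. partial_deriv i ^^ \<alpha> i) is f) h"
  using \<open>distinct is\<close>
proof (induction "is")
  case Nil
  then show ?case using rf by auto
next
  case (Cons a xs)
  let ?g = "foldr (\<lambda>i. partial_deriv i ^^ \<alpha> i) xs f"
  define \<gamma> where "\<gamma> = (\<lambda>j. if j \<in> set xs then \<alpha> j else 0)"
  have "\<exists>h. newtonian_form \<gamma> ?g h" using Cons by (simp add: \<gamma>_def)
  then have step: "\<exists>h. newtonian_form (\<gamma>(a := \<gamma> a + k)) ((partial_deriv a ^^ k) ?g) h" for k
  proof (induction k)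
    case (Suc k)
    then obtain h where "newtonian_form (\<gamma>(a := \<gamma> a + k)) ((partial_deriv a ^^ k) ?g) h" by blast
    from newtonian_form_partial_deriv[OF n this, of a]
    have "\<exists>h. newtonian_form ((\<gamma>(a := \<gamma> a + k))(a := (\<gamma>(a := \<gamma> a + k)) a + 1))
        (partial_deriv a ((partial_deriv a ^^ k) ?g)) h"
      by blast
    moreover have "(\<gamma>(a := \<gamma> a + k))(a := (\<gamma>(a := \<gamma> a + k)) a + 1) = \<gamma>(a := \<gamma> a + Suc k)"
      by simp
    ultimately show ?case by (simp only: funpow.simps comp_apply)
  qed simp
  have "\<gamma>(a := \<gamma> a + \<alpha> a) = (\<lambda>j. if j \<in> set (a # xs) then \<alpha> j else 0)"
    using Cons.prems by (auto simp: \<gamma>_def)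
  then show ?case using step[of "\<alpha> a"] by (simp only: foldr.simps comp_apply)
qed

lemma newtonian_form_multi_deriv:
  fixes \<alpha> :: "'n::{finite,linorder} \<Rightarrow> nat"
  assumes "2 < CARD('n)"
  shows "\<exists>h. newtonian_form \<alpha> (multi_deriv \<alpha> (\<lambda>y. complex_of_real (norm y powi (2 - int CARD('n))))) h"
proof -
  have "1 - cscale 1 (monomial (\<lambda>_::'n. 0)) \<in> radial_multiples 0"
    by (simp add: monomial_0 radial_multiples_0)
  then have "\<exists>c. c \<noteq> 0 \<and> 1 - cscale c (monomial (\<lambda>_::'n. 0)) \<in> radial_multiples 0"
    using zero_neq_one by metis
  then have "newtonian_form (\<lambda>_::'n. 0) (\<lambda>y. complex_of_real (norm y powi (2 - int CARD('n)))) 1"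
    by (simp add: newtonian_form_def one_fun_apply laplacian_1 homogeneous_1)
  from newtonian_form_foldr[OF assms _ this, of "sorted_list_of_set UNIV" \<alpha>]
  show ?thesis by (simp add: multi_deriv_def)
qed

section \<open>The Kelvin transform\<close>

lemma homogeneous_polynomial_scaleR:
  assumes "homogeneous_polynomial d f"
  shows "f (r *\<^sub>R x) = complex_of_real r ^ d * f x"
  using assms
proof (induction rule: homogeneous_polynomial_induct)
  case (add d f g)
  then show "(f + g) (r *\<^sub>R x) = complex_of_real r ^ d * (f + g) x"
    by (simp only: plus_fun_apply distrib_left)
next
  case (coord d f i)
  then show "(coord i * f) (r *\<^sub>R x) = complex_of_real r ^ Suc d * (coord i * f) x"
    by (simp add: coord_def times_fun_apply)
qed simp

lemma homogeneous_polynomial_imp_polynomial_function: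
  assumes "homogeneous_polynomial d f"
  shows "polynomial_function f"
proof -
  obtain c where f: "f x = (\<Sum>\<alpha>\<in>exponents d. c \<alpha> * complex_of_real (\<Prod>i\<in>UNIV. (x $ i) ^ \<alpha> i))" for x
    using assms by (auto simp: homogeneous_polynomial_def exponents_def)
  have "polynomial_function (\<lambda>x::real^'a. c \<alpha> * complex_of_real (\<Prod>i\<in>UNIV. (x $ i) ^ \<alpha> i))" for \<alpha>
  proof -
    have "real_polynomial_function (\<lambda>x::real^'a. \<Prod>i\<in>UNIV. (x $ i) ^ \<alpha> i)"
      by (intro real_polynomial_function_prod real_polynomial_function_power
          real_polynomial_function.intros(1) bounded_linear_vec_nth) simp
    then have "polynomial_function (\<lambda>x::real^'a. (\<Prod>i\<in>UNIV. (x $ i) ^ \<alpha> i) *\<^sub>R c \<alpha>)"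
      by (intro polynomial_function_mult) (simp_all add: real_polynomial_function_eq)
    then show ?thesis by (simp add: scaleR_conv_of_real mult.commute)
  qed
  then have "polynomial_function (\<lambda>x. \<Sum>\<alpha>\<in>exponents d. c \<alpha> * complex_of_real (\<Prod>i\<in>UNIV. (x $ i) ^ \<alpha> i))"
    by (intro polynomial_function_sum finite_exponents)
  then show ?thesis by (simp only: f[symmetric])
qed

text \<open>
  Polynomials are continuous and the origin is a limit point, so the values elsewhere determine
  the value at the origin.
\<close>
lemma as_polynomial_eqI:
  fixes q :: "real^'n::finite \<Rightarrow> complex"
  assumes q: "polynomial_function q" and f: "\<And>x. x \<noteq> 0 \<Longrightarrow> f x = q x"
  shows "as_polynomial f = q"
  unfolding as_polynomial_def
proof (rule the_equality)
  show "polynomial_function q \<and> (\<forall>x. x \<noteq> 0 \<longrightarrow> q x = f x)" using q f by simp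
next
  fix p assume p: "polynomial_function p \<and> (\<forall>x. x \<noteq> 0 \<longrightarrow> p x = f x)"
  have "p \<midarrow>0\<rightarrow> p 0" "q \<midarrow>0\<rightarrow> q 0"
    using continuous_polymonial_function p q by (auto simp: isCont_def)
  moreover have "eventually (\<lambda>x. q x = p x) (at 0)"
    using p f by (auto simp: eventually_at_filter)
  ultimately have "p \<midarrow>0\<rightarrow> p 0" "p \<midarrow>0\<rightarrow> q 0"
    using tendsto_cong by blast+
  then have "p 0 = q 0" using tendsto_unique[OF at_neq_bot] by blast
  then show "p = q" using p f by (metis ext)
qed

text \<open>
  Under \<open>x \<mapsto> x / |x|\<^sup>2\<close> the factor \<open>|x|\<^sup>2\<^sup>-\<^sup>n\<^sup>-\<^sup>2\<^sup>d\<close> is inverted and \<open>h\<close>, being homogeneous of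
  degree \<open>d\<close>, picks up \<open>|x|\<^sup>-\<^sup>2\<^sup>d\<close>; together with the factor \<open>|x|\<^sup>2\<^sup>-\<^sup>n\<close> of the Kelvin transform
  everything cancels, and the transform of the derivative is \<open>h\<close> itself.
\<close>
lemma v_kelvin_eq:
  fixes \<alpha> :: "'n::{finite,linorder} \<Rightarrow> nat"
  assumes rf: "newtonian_form \<alpha> (multi_deriv \<alpha> (\<lambda>y. complex_of_real (norm y powi (2 - int CARD('n))))) h"
  shows "v_kelvin k \<alpha> = rsq ^ k * h"
  unfolding v_kelvin_def
proof (rule as_polynomial_eqI)
  define d where "d = (\<Sum>i\<in>UNIV. \<alpha> i)"
  have hp: "homogeneous_polynomial d h" using rf by (simp add: newtonian_form_def d_def)
  show "polynomial_function (rsq ^ k * h)"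
    using homogeneous_polynomial_imp_polynomial_function[OF homogeneous_rsq_power_mult[OF hp]] .
  fix x :: "real^('n::{finite,linorder})"
  assume x: "x \<noteq> 0"
  let ?s = "2 - int CARD('n)"
  let ?F = "multi_deriv \<alpha> (\<lambda>y. complex_of_real (norm y powi ?s))"
  let ?y = "x /\<^sub>R (norm x)\<^sup>2"
  have y: "?y \<noteq> 0" "norm ?y = inverse (norm x)" using x by (auto simp: power2_eq_square)
  have "kelvin ?F x = complex_of_real (norm x powi ?s) * ?F ?y"
    by (simp add: kelvin_def)
  also have "?F ?y = complex_of_real (inverse (norm x) powi (?s - 2 * int d)) * h ?y"
    using rf y by (simp add: newtonian_form_def d_def)
  also have "h ?y = complex_of_real (inverse ((norm x)\<^sup>2)) ^ d * h x"
    by (rule homogeneous_polynomial_scaleR[OF hp])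
  also have "complex_of_real (norm x powi ?s) * (complex_of_real (inverse (norm x) powi (?s - 2 * int d))
      * (complex_of_real (inverse ((norm x)\<^sup>2)) ^ d * h x))
    = complex_of_real (norm x powi ?s * (inverse (norm x) powi (?s - 2 * int d) * inverse ((norm x)\<^sup>2) ^ d)) * h x"
    by simp
  also have "norm x powi ?s * (inverse (norm x) powi (?s - 2 * int d) * inverse ((norm x)\<^sup>2) ^ d) = 1"
  proof -
    have "inverse (norm x) powi (?s - 2 * int d) = norm x powi (2 * int d - ?s)"
      using power_int_minus[of "norm x" "?s - 2 * int d"] by (simp add: power_int_inverse)
    moreover have "inverse ((norm x)\<^sup>2) ^ d = norm x powi (- 2 * int d)"
      by (simp add: power_int_minus power_inverse power_int_mult)
    moreover have "norm x powi ?s * (norm x powi (2 * int d - ?s) * norm x powi (- 2 * int d))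
        = norm x powi (?s + ((2 * int d - ?s) + - 2 * int d))"
      using x by (simp only: power_int_add norm_eq_zero simp_thms)
    ultimately show ?thesis by simp
  qed
  finally have "kelvin ?F x = h x" by simp
  then show "complex_of_real (norm x ^ (2 * k)) * kelvin ?F x = (rsq ^ k * h) x"
    by (simp add: times_fun_apply rsq_power_apply)
qed

lemma kelvin_basis:
  assumes "2 < CARD('n::{finite,linorder})"
  shows "is_basis_of
     {v_kelvin k \<alpha> | k (\<alpha> :: 'n::{finite,linorder} \<Rightarrow> nat).
        (\<Sum>i\<in>UNIV. \<alpha> i) + 2 * k = m \<and> \<alpha> (Min UNIV) \<le> 1 \<and> k < p}
     (polyharmonic_homogeneous m p :: (real^('n::{finite,linorder}) \<Rightarrow> complex) set)"
proof -
  obtain h where h: "\<And>\<alpha>. newtonian_form \<alpha>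
      (multi_deriv \<alpha> (\<lambda>y::real^('n::{finite,linorder}).
        complex_of_real (norm y powi (2 - int CARD('n::{finite,linorder}))))) (h \<alpha>)"
    using newtonian_form_multi_deriv[OF assms] by metis
  interpret triangular_harmonic_family "Min UNIV :: 'n::{finite,linorder}" h
    by standard (use h in \<open>auto simp: newtonian_form_def exponents_def\<close>)
  have "{v_kelvin k \<alpha> | k (\<alpha> :: 'n::{finite,linorder} \<Rightarrow> nat).
        (\<Sum>i\<in>UNIV. \<alpha> i) + 2 * k = m \<and> \<alpha> (Min UNIV) \<le> 1 \<and> k < p}
      = family m p"
    unfolding family_def v_kelvin_eq[OF h] ..
  then show ?thesis using family_is_basis by simp
qed

theorem theorem3:
  fixes m p :: nat
  assumes "1 \<le> m" and "1 \<le> p"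
  shows "is_basis_of
           ({v_re m k | k. k < p \<and> 2 * k \<le> m} \<union> {v_im m k | k. k < p \<and> 2 * k < m})
           (polyharmonic_homogeneous m p :: (real^2 \<Rightarrow> complex) set)
       \<and> (2 < CARD('n::{finite,linorder}) \<longrightarrow>
          is_basis_of
           {v_kelvin k \<alpha> | k (\<alpha> :: 'n::{finite,linorder} \<Rightarrow> nat).
              (\<Sum>i\<in>UNIV. \<alpha> i) + 2 * k = m \<and> \<alpha> (Min UNIV) \<le> 1 \<and> k < p}
           (polyharmonic_homogeneous m p :: (real^('n::{finite,linorder}) \<Rightarrow> complex) set))"
  using planar.family_is_basis[of m p] kelvin_basis[of m p, where 'n = 'n]
  unfolding planar_family_eq by blast

end
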